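(* Let $(T(t))_{t\ge 0}$ be a bounded $C_0$-semigroup on a Hilbert space, with generator $-A$. Assume that $\sigma(A)\cap i\mathbb{R}\subset\{0\}$, and let $\alpha>1$, $\beta\ge 0$. The following statements are equivalent: (i) $\|(is+A)^{-1}\| = O\left(|s|^{-\alpha}(\log(1/|s|))^{-\beta}\right)$ as $s\to 0$, and $\|(is+A)^{-1}\|=O(1)$ as $|s|\to\infty$ ($s\in\mathbb{R}$); (ii) $\|T(t)A(I+A)^{-1}\| = O\left(t^{-1/\alpha}(\log t)^{-\beta/\alpha}\right)$ as $t\to\infty$.
   Context: The generator of the semigroup is denoted by $-A$ (not $A$); $\sigma(A)$ is the spectrum of $A$. Spaces are complex. *)

theory Defs
  imports "HOL-Analysis.Analysis" "HOL-Library.Landau_Symbols"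
begin

class complex_vector = real_vector +
  fixes scaleC :: "complex \<Rightarrow> 'a \<Rightarrow> 'a"  (infixr \<open>*\<^sub>C\<close> 75)
  assumes scaleC_add_right: "a *\<^sub>C (x + y) = a *\<^sub>C x + a *\<^sub>C y"
    and scaleC_add_left: "(a + b) *\<^sub>C x = a *\<^sub>C x + b *\<^sub>C x"
    and scaleC_scaleC: "a *\<^sub>C b *\<^sub>C x = (a * b) *\<^sub>C x"
    and scaleR_scaleC: "r *\<^sub>R x = complex_of_real r *\<^sub>C x"

text \<open>The inner product is linear in the first and conjugate linear in the second argument.\<close>

class complex_inner = complex_vector + real_normed_vector +
  fixes cinner :: "'a \<Rightarrow> 'a \<Rightarrow> complex"
  assumes cinner_commute: "cinner x y = cnj (cinner y x)"
    and cinner_add_left: "cinner (x + y) z = cinner x z + cinner y z"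
    and cinner_scaleC_left: "cinner (a *\<^sub>C x) y = a * cinner x y"
    and cinner_ge_zero: "0 \<le> Re (cinner x x)"
    and cinner_eq_zero_iff: "cinner x x = 0 \<longleftrightarrow> x = 0"
    and norm_eq_sqrt_cinner: "norm x = sqrt (Re (cinner x x))"

class chilbert_space = complex_inner + complete_space

instantiation complex :: chilbert_space
begin

definition scaleC_complex :: "complex \<Rightarrow> complex \<Rightarrow> complex"
  where "scaleC_complex a x = a * x"

definition cinner_complex :: "complex \<Rightarrow> complex \<Rightarrow> complex"
  where "cinner_complex x y = x * cnj y"

instance
proof
  fix a b x y z :: complex and r :: real
  show "a *\<^sub>C (x + y) = a *\<^sub>C x + a *\<^sub>C y" "(a + b) *\<^sub>C x = a *\<^sub>C x + b *\<^sub>C x"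
    "a *\<^sub>C b *\<^sub>C x = (a * b) *\<^sub>C x" "r *\<^sub>R x = complex_of_real r *\<^sub>C x"
    by (simp_all add: scaleC_complex_def algebra_simps scaleR_conv_of_real)
  show "cinner x y = cnj (cinner y x)" "cinner (x + y) z = cinner x z + cinner y z"
    "cinner (a *\<^sub>C x) y = a * cinner x y" "0 \<le> Re (cinner x x)"
    "cinner x x = 0 \<longleftrightarrow> x = 0"
    by (simp_all add: scaleC_complex_def cinner_complex_def algebra_simps)
  show "norm x = sqrt (Re (cinner x x))"
    by (simp add: cinner_complex_def norm_complex_def power2_eq_square)
qed

end

definition bounded_clinear :: "('a::complex_inner \<Rightarrow> 'b::complex_inner) \<Rightarrow> bool"
  where "bounded_clinear f \<longleftrightarrow> bounded_linear f \<and> (\<forall>c x. f (c *\<^sub>C x) = c *\<^sub>C f x)"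

text \<open>Only the values of \<open>T\<close> at nonnegative arguments matter.\<close>

definition C0_semigroup :: "(real \<Rightarrow> 'a::complex_inner \<Rightarrow> 'a) \<Rightarrow> bool"
  where "C0_semigroup T \<longleftrightarrow>
    (\<forall>t\<ge>0. bounded_clinear (T t)) \<and>
    T 0 = id \<and>
    (\<forall>s\<ge>0. \<forall>t\<ge>0. T (s + t) = T s \<circ> T t) \<and>
    (\<forall>x. ((\<lambda>t. T t x) \<longlongrightarrow> x) (at_right 0))"

definition bounded_semigroup :: "(real \<Rightarrow> 'a::complex_inner \<Rightarrow> 'a) \<Rightarrow> bool"
  where "bounded_semigroup T \<longleftrightarrow> (\<exists>M. \<forall>t\<ge>0. onorm (T t) \<le> M)"

text \<open>
  An unbounded operator is given by its domain \<open>D\<close> together with a total function, whose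
  values outside \<open>D\<close> are irrelevant.
\<close>

definition is_generator ::
    "(real \<Rightarrow> 'a::complex_inner \<Rightarrow> 'a) \<Rightarrow> 'a set \<Rightarrow> ('a \<Rightarrow> 'a) \<Rightarrow> bool"
  where "is_generator T D B \<longleftrightarrow>
    D = {x. \<exists>y. ((\<lambda>h. (T h x - x) /\<^sub>R h) \<longlongrightarrow> y) (at_right 0)} \<and>
    (\<forall>x\<in>D. ((\<lambda>h. (T h x - x) /\<^sub>R h) \<longlongrightarrow> B x) (at_right 0))"

definition resolvent_set :: "'a::complex_inner set \<Rightarrow> ('a \<Rightarrow> 'a) \<Rightarrow> complex set"
  where "resolvent_set D A =
    {z. bij_betw (\<lambda>x. z *\<^sub>C x - A x) D UNIV \<and>
        bounded_clinear (inv_into D (\<lambda>x. z *\<^sub>C x - A x))}"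

definition spectrum :: "'a::complex_inner set \<Rightarrow> ('a \<Rightarrow> 'a) \<Rightarrow> complex set"
  where "spectrum D A = - resolvent_set D A"

end

theory Submission
  imports Defs
begin

text \<open>
  Write \<open>R(z) = (z + A)\<^sup>-\<^sup>1\<close>, which is the Laplace integral of \<open>T\<close> for \<open>Re z > 0\<close>, and
  \<open>B = A (1 + A)\<^sup>-\<^sup>1 = 1 - R(1)\<close>. Put \<open>m(s) = s powr (- \<alpha>) * ln (1/s) powr (- \<beta>)\<close> and
  \<open>d(t) = t powr (- 1/\<alpha>) * ln t powr (- \<beta>/\<alpha>)\<close>; up to constants \<open>d\<close> inverts \<open>m\<close>, in the sense
  that \<open>m (d t)\<close> is at most a multiple of \<open>t\<close>.

  From the resolvent to the semigroup, the key is a principle that rests on the inner product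
  (\<open>semigroup_decay\<close>): if \<open>C\<close> commutes with the semigroup and \<open>norm (R(z) C) \<le> M\<close> whenever
  \<open>Re z \<ge> 1/(2t)\<close>, then \<open>norm (T t C)\<close> is at most a constant times \<open>M / t\<close>. The reason is that
  the Fourier transform of \<open>s \<mapsto> s e\<^sup>-\<^sup>\<epsilon>\<^sup>s T(s) C x\<close> is \<open>R(z) C\<close> applied to that of
  \<open>s \<mapsto> e\<^sup>-\<^sup>\<epsilon>\<^sup>s T(s) x\<close>, so that Plancherel's theorem bounds the square integral of the former by
  \<open>M\<^sup>2\<close> times that of the latter, which is of order \<open>t\<close> for \<open>\<epsilon> = 1/t\<close>; and a lower bound of order
  \<open>t\<^sup>3 norm (T(t) C x)\<^sup>2\<close> for the former comes from the boundedness of \<open>T\<close>. Finite sums suffice for this: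
  the semigroup is replaced by the powers of a step \<open>(1 + h A)\<^sup>-\<^sup>1\<close> of the implicit Euler scheme, and
  Plancherel's theorem by the Parseval identity of the discrete Fourier transform on \<open>N\<close> points
  (\<open>parseval_DFT\<close>, \<open>power_bounded_decay\<close>). The exponential formula \<open>euler_power_tendsto\<close>
  carries the result over to \<open>T\<close>.

  It remains to see that \<open>norm (R(z) B)\<close> is at most a multiple of \<open>t d(t)\<close> for \<open>Re z \<ge> 1/(2t)\<close>. As
  \<open>R(z) A = 1 - z R(z)\<close>, this amounts near \<open>0\<close> to a bound for \<open>\<bar>s\<bar> norm (R(z))\<close>, \<open>s = Im z\<close>. For
  \<open>\<bar>s\<bar> \<le> d(t)\<close> one has \<open>norm (R(z)) = O(t)\<close>, from the boundedness of \<open>T\<close>; for \<open>\<bar>s\<bar> \<ge> d(t)\<close> one has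
  \<open>norm (R(z)) = O(m \<bar>s\<bar>)\<close>, and \<open>s m(s)\<close> decreases in \<open>s\<close> because \<open>\<alpha> > 1\<close>.

  In the converse direction, \<open>R(z) B x\<close> is an integral of \<open>e\<^sup>-\<^sup>z\<^sup>\<tau> T(\<tau>) B x\<close> over \<open>[0, t]\<close> plus
  \<open>e\<^sup>-\<^sup>z\<^sup>t R(z) T(t) B x\<close>. The integral is \<open>O(t d(t))\<close>, since \<open>1/\<alpha> < 1\<close>, and the last term is
  absorbed into \<open>z R(z)\<close> when \<open>t\<close> is a large multiple of \<open>m \<bar>s\<bar>\<close>, which makes \<open>d(t)\<close> a small multiple
  of \<open>\<bar>s\<bar>\<close>. This bounds \<open>norm (R(z))\<close> by a multiple of \<open>m \<bar>s\<bar>\<close>, uniformly in the real part of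
  \<open>z\<close>, which then tends to \<open>0\<close>.
\<close>

section \<open>Complex inner product spaces\<close>

instance chilbert_space \<subseteq> banach ..

lemma scaleC_one [simp]: "1 *\<^sub>C x = (x :: 'a::complex_vector)"
  using scaleR_scaleC[of 1 x] by simp

lemma scaleC_zero_left [simp]: "0 *\<^sub>C x = (0 :: 'a::complex_vector)"
  using scaleR_scaleC[of 0 x] by simp

lemma scaleC_minus_left: "(- a) *\<^sub>C x = - (a *\<^sub>C (x :: 'a::complex_vector))"
  using scaleC_add_left[of a "- a" x] by (simp add: eq_neg_iff_add_eq_0 add.commute)

lemma scaleC_diff_left: "(a - b) *\<^sub>C x = a *\<^sub>C x - b *\<^sub>C (x :: 'a::complex_vector)"
  using scaleC_add_left[of a "- b" x] by (simp add: scaleC_minus_left)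

lemma norm_eq_cinner: "(norm x)\<^sup>2 = Re (cinner x (x :: 'a::complex_inner))"
  by (simp add: norm_eq_sqrt_cinner cinner_ge_zero)

lemma cinner_self: "cinner x x = complex_of_real ((norm (x :: 'a::complex_inner))\<^sup>2)"
proof -
  have "Im (cinner x x) = 0"
    using arg_cong[OF cinner_commute[of x x], of Im] by simp
  then show ?thesis by (simp add: norm_eq_cinner complex_eq_iff)
qed

lemma norm_scaleC: "norm (c *\<^sub>C x) = cmod c * norm (x :: 'a::complex_inner)"
proof -
  have "cinner (c *\<^sub>C x) (c *\<^sub>C x) = c * cnj (c * cinner x x)"
    by (metis cinner_commute cinner_scaleC_left)
  also have "\<dots> = complex_of_real ((cmod c * norm x)\<^sup>2)"
    by (simp add: cinner_self power_mult_distrib mult.assoc[symmetric] complex_norm_square[symmetric])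
  finally have "(norm (c *\<^sub>C x))\<^sup>2 = (cmod c * norm x)\<^sup>2"
    by (metis cinner_self of_real_eq_iff)
  then show ?thesis by (simp add: power2_eq_iff_nonneg)
qed

lemma bounded_bilinear_scaleC: "bounded_bilinear (scaleC :: complex \<Rightarrow> 'a::complex_inner \<Rightarrow> 'a)"
proof
  fix a b :: complex and r :: real and x y :: 'a
  show "(a + b) *\<^sub>C x = a *\<^sub>C x + b *\<^sub>C x" by (rule scaleC_add_left)
  show "a *\<^sub>C (x + y) = a *\<^sub>C x + a *\<^sub>C y" by (rule scaleC_add_right)
  show "(r *\<^sub>R a) *\<^sub>C x = r *\<^sub>R (a *\<^sub>C x)"
    by (simp add: scaleR_scaleC[where 'a='a] scaleC_scaleC scaleR_conv_of_real)
  show "a *\<^sub>C (r *\<^sub>R x) = r *\<^sub>R (a *\<^sub>C x)"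
    by (simp add: scaleR_scaleC scaleC_scaleC mult.commute)
  show "\<exists>K. \<forall>a x. norm (a *\<^sub>C (x :: 'a)) \<le> norm a * norm x * K"
    by (intro exI[of _ 1]) (simp add: norm_scaleC)
qed

lemmas bounded_linear_scaleC_right =
  bounded_bilinear.bounded_linear_right[OF bounded_bilinear_scaleC]
lemmas scaleC_right_simps =
  bounded_bilinear.zero_right[OF bounded_bilinear_scaleC]
  bounded_bilinear.minus_right[OF bounded_bilinear_scaleC]
  bounded_bilinear.diff_right[OF bounded_bilinear_scaleC]
lemmas tendsto_scaleC = bounded_bilinear.tendsto[OF bounded_bilinear_scaleC]
lemmas continuous_on_scaleC = bounded_bilinear.continuous_on[OF bounded_bilinear_scaleC]

lemma bounded_clinear_linear: "bounded_clinear f \<Longrightarrow> bounded_linear f"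
  and bounded_clinear_scaleC: "bounded_clinear f \<Longrightarrow> f (c *\<^sub>C x) = c *\<^sub>C f x"
  by (auto simp: bounded_clinear_def)

lemma cinner_sum_left: "cinner (\<Sum>i\<in>I. f i) z = (\<Sum>i\<in>I. cinner (f i :: 'a::complex_inner) z)"
proof -
  have z: "cinner 0 z = 0" using cinner_scaleC_left[of 0 0 z] by simp
  show ?thesis by (induction I rule: infinite_finite_induct) (auto simp: z cinner_add_left)
qed

lemma cinner_sum_right: "cinner z (\<Sum>i\<in>I. f i) = (\<Sum>i\<in>I. cinner z (f i :: 'a::complex_inner))"
  by (subst cinner_commute, subst cinner_sum_left, subst cnj_sum) (metis cinner_commute)

lemma cinner_scaleC_right: "cinner x (a *\<^sub>C y) = cnj a * cinner x (y :: 'a::complex_inner)"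
  by (metis cinner_commute cinner_scaleC_left complex_cnj_mult)

section \<open>The discrete Fourier transform\<close>

definition unity_root :: "nat \<Rightarrow> nat \<Rightarrow> complex"
  where "unity_root N k = cis (2 * pi * real k / real N)"

lemma unity_root_power: "unity_root N k ^ j = unity_root N j ^ k"
  by (simp add: unity_root_def Complex.DeMoivre field_simps)

lemma unity_root_power_N: "N > 0 \<Longrightarrow> unity_root N k ^ N = 1"
  by (simp add: unity_root_def Complex.DeMoivre cis_multiple_2pi)

lemma norm_unity_root [simp]: "cmod (unity_root N k) = 1"
  by (simp add: unity_root_def)

text \<open>
  The sum is a geometric one, with a ratio that is an \<open>N\<close>-th root of unity.
\<close>
lemma unity_root_orthogonal:
  assumes N: "N > 0" and "j < N" "l < N"
  shows "(\<Sum>k<N. unity_root N k ^ j * cnj (unity_root N k ^ l)) = (if j = l then of_nat N else 0)"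
proof -
  define z where "z = unity_root N j * cnj (unity_root N l)"
  have *: "unity_root N k ^ j * cnj (unity_root N k ^ l) = z ^ k" for k
    by (simp add: z_def unity_root_power[of N k] power_mult_distrib)
  have inv: "cnj (unity_root N l) * unity_root N l = 1"
    using complex_norm_square[of "unity_root N l"] by (simp add: mult.commute)
  show ?thesis
  proof (cases "j = l")
    case True
    then have "z = 1" using inv by (simp add: z_def mult.commute)
    then show ?thesis using True unfolding * by simp
  next
    case False
    have "z ^ N = 1" using N unity_root_power_N[OF N] by (simp add: z_def power_mult_distrib complex_cnj_power[symmetric] del: complex_cnj_power)
    moreover have "z \<noteq> 1"
    proof
      assume "z = 1"
      then have "unity_root N j = unity_root N l" using inv by (metis z_def mult.assoc mult.right_neutral mult.left_neutral)
      moreover have "inj_on (unity_root N) {..<N}"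
        using bij_betw_imp_inj_on[OF Complex.bij_betw_roots_unity[OF N]] by (simp add: unity_root_def inj_on_def)
      ultimately show False using assms False by (auto dest: inj_onD)
    qed
    ultimately show ?thesis using False unfolding * by (simp add: sum_gp_strict)
  qed
qed

lemma parseval_DFT:
  fixes f :: "nat \<Rightarrow> 'a::complex_inner"
  assumes N: "N > 0"
  shows "(\<Sum>k<N. (norm (\<Sum>j<N. unity_root N k ^ j *\<^sub>C f j))\<^sup>2) = real N * (\<Sum>j<N. (norm (f j))\<^sup>2)"
proof -
  have "complex_of_real (\<Sum>k<N. (norm (\<Sum>j<N. unity_root N k ^ j *\<^sub>C f j))\<^sup>2)
     = (\<Sum>k<N. \<Sum>j<N. \<Sum>l<N. unity_root N k ^ j * cnj (unity_root N k ^ l) * cinner (f j) (f l))"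
    unfolding of_real_sum cinner_self[symmetric] cinner_sum_left cinner_sum_right
      cinner_scaleC_left cinner_scaleC_right
    by (simp add: mult.assoc mult.left_commute sum_distrib_left)
       (rule sum.cong[OF refl], rule sum.swap)
  also have "\<dots> = (\<Sum>j<N. \<Sum>l<N. \<Sum>k<N. unity_root N k ^ j * cnj (unity_root N k ^ l) * cinner (f j) (f l))"
    by (subst sum.swap, rule sum.cong[OF refl], rule sum.swap)
  also have "\<dots> = (\<Sum>j<N. \<Sum>l<N. (if j = l then of_nat N else 0) * cinner (f j) (f l))"
    by (intro sum.cong refl) (simp add: sum_distrib_right[symmetric] unity_root_orthogonal[OF N] del: complex_cnj_power)
  also have "\<dots> = (\<Sum>j<N. of_nat N * cinner (f j) (f j))"
    by (intro sum.cong refl) (simp add: if_distrib[of "\<lambda>x. x * _"] cong: if_cong)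
  also have "\<dots> = complex_of_real (real N * (\<Sum>j<N. (norm (f j))\<^sup>2))"
    by (simp add: cinner_self sum_distrib_left)
  finally show ?thesis using of_real_eq_iff by blast
qed

section \<open>Decay of powers of an operator\<close>

lemma sum_squares_ge: "real n ^ 3 / 3 \<le> (\<Sum>j\<le>n. (real j)\<^sup>2)"
proof (induction n)
  case (Suc n)
  have "real (Suc n) ^ 3 / 3 \<le> real n ^ 3 / 3 + (real (Suc n))\<^sup>2"
    by (simp add: power2_eq_square power3_eq_cube field_simps)
  then show ?case using Suc by simp
qed simp

text \<open>
  The left side of the Parseval estimate carries the weights \<open>r ^ (2 * j)\<close>; with this choice of the
  radius \<open>r\<close> they do not degenerate for \<open>j \<le> n\<close>.
\<close>
lemma root_near_one_power_ge:
  assumes "n > 0"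
  shows "1 / 9 \<le> (real n / real (Suc n)) ^ (2 * n)"
proof -
  have "(real (Suc n) / real n) ^ n = (1 + 1 / real n) ^ n"
    using assms by (simp add: field_simps)
  also have "\<dots> \<le> exp (1 / real n) ^ n"
    by (intro power_mono exp_ge_add_one_self) auto
  also have "\<dots> = exp 1" using assms by (simp flip: exp_of_nat_mult)
  finally have "(real (Suc n) / real n) ^ n \<le> 3" using exp_le by linarith
  then have "1 / 3 \<le> inverse ((real (Suc n) / real n) ^ n)"
    using assms by (simp add: field_simps)
  then have *: "1 / 3 \<le> (real n / real (Suc n)) ^ n"
    by (simp add: power_inverse[symmetric] del: of_nat_Suc)
  show ?thesis
    using power_mono[OF *, of 2]
    by (simp add: power_mult mult.commute[of 2] power_divide[of 1] del: of_nat_Suc)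
qed

text \<open>
  This is the discrete form of the fact that multiplication by the index corresponds to the square of
  \<open>(1 - z V)\<^sup>-\<^sup>1\<close>: applying \<open>1 - z V\<close> to the transform of \<open>j V\<^sup>j y\<close> gives the transform of
  \<open>V\<^sup>j y\<close>, up to boundary terms.
\<close>
lemma telescope_index_sum:
  fixes V :: "'a::complex_inner \<Rightarrow> 'a"
  assumes V: "bounded_clinear V"
  shows "(\<Sum>j<Suc N. z ^ j *\<^sub>C (real j *\<^sub>R (V ^^ j) y)) - z *\<^sub>C V (\<Sum>j<Suc N. z ^ j *\<^sub>C (real j *\<^sub>R (V ^^ j) y))
    = (\<Sum>j<Suc N. z ^ j *\<^sub>C (V ^^ j) y) - y - (real N *\<^sub>R (z ^ Suc N *\<^sub>C (V ^^ Suc N) y))"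
proof (induction N)
  case 0
  interpret bounded_linear V using V by (rule bounded_clinear_linear)
  show ?case by (simp add: zero scaleC_right_simps)
next
  case (Suc N)
  interpret bounded_linear V using V by (rule bounded_clinear_linear)
  let ?f = "\<lambda>j. z ^ j *\<^sub>C (real j *\<^sub>R (V ^^ j) y)"
  let ?w = "z ^ Suc N *\<^sub>C (V ^^ Suc N) y" and ?w' = "z ^ Suc (Suc N) *\<^sub>C (V ^^ Suc (Suc N)) y"
  have 1: "?f (Suc N) = real (Suc N) *\<^sub>R ?w"
    by (simp add: scaleR_scaleC[where 'a='a] scaleC_scaleC mult.commute del: funpow.simps)
  have "z *\<^sub>C V ?w = ?w'"
    using V by (simp add: bounded_clinear_scaleC scaleC_scaleC)
  then have 2: "z *\<^sub>C V (?f (Suc N)) = real (Suc N) *\<^sub>R ?w'"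
    unfolding 1 by (simp only: scaleR linear_scale[OF bounded_linear.linear, OF bounded_linear_scaleC_right])
  show ?case
    unfolding sum.lessThan_Suc[of _ "Suc N"] add scaleC_add_right 2 using Suc
    unfolding 1 by (simp add: algebra_simps del: funpow.simps sum.lessThan_Suc)
qed

text \<open>
  On the circle of radius \<open>r\<close>, the discrete Fourier transform of \<open>v\<^sub>j = j r\<^sup>j V\<^sup>j B x\<close> is \<open>P z B\<close>
  applied to the transform of a sequence \<open>u\<close> that agrees with \<open>r\<^sup>j V\<^sup>j x\<close> except for \<open>j = 0\<close>,
  where it contains the boundary term from the end of the sequence. Two applications of the Parseval
  identity turn the uniform bound for \<open>P z B\<close> into an \<open>l\<^sup>2\<close> estimate.
\<close>
lemma weighted_orbit_sum_le:
  fixes V B :: "'a::complex_inner \<Rightarrow> 'a" and P :: "complex \<Rightarrow> 'a \<Rightarrow> 'a"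
  assumes V: "bounded_clinear V" and B: "bounded_clinear B"
    and comm: "\<And>x. B (V x) = V (B x)"
    and Vbd: "\<And>n x. norm ((V ^^ n) x) \<le> K * norm x"
    and r: "0 < r" "r < 1"
    and P: "\<And>z x. cmod z = r \<Longrightarrow> P z (x - z *\<^sub>C V x) = x"
    and PB: "\<And>z x. cmod z = r \<Longrightarrow> norm (P z (B x)) \<le> b * norm x"
  shows "(\<Sum>j\<le>N. (real j)\<^sup>2 * r ^ (2 * j) * (norm ((V ^^ j) (B x)))\<^sup>2)
    \<le> b\<^sup>2 * K\<^sup>2 * (norm x)\<^sup>2 * (1 / (1 - r) + (real N * r ^ Suc N)\<^sup>2)"
proof -
  interpret B: bounded_linear B using B by (rule bounded_clinear_linear)
  have commn: "B ((V ^^ j) w) = (V ^^ j) (B w)" for j w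
    by (induction j) (auto simp: comm)
  let ?M = "Suc N"
  have M: "?M > 0" by simp
  define v where "v j = r ^ j *\<^sub>R (real j *\<^sub>R (V ^^ j) (B x))" for j
  \<comment> \<open>The transform of \<open>V\<^sup>j x\<close>, minus the two boundary terms of \<open>telescope_index_sum\<close>: removing
    \<open>x\<close> and adding the other one only changes the entry at \<open>0\<close>.\<close>
  define u where "u j = (if j = 0 then - (real N *\<^sub>R (r ^ ?M *\<^sub>R (V ^^ ?M) x)) else r ^ j *\<^sub>R (V ^^ j) x)" for j
  have vhat: "norm (\<Sum>j<?M. unity_root ?M k ^ j *\<^sub>C v j) \<le> b * norm (\<Sum>j<?M. unity_root ?M k ^ j *\<^sub>C u j)" for k
  proof -
    define z where "z = complex_of_real r * unity_root ?M k"
    have z: "cmod z = r" using r by (simp add: z_def norm_mult)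
    \<comment> \<open>All points \<open>z\<close> have the same power of exponent \<open>N + 1\<close>, so the boundary term does not depend on
      \<open>k\<close>.\<close>
    have zM: "z ^ ?M = complex_of_real (r ^ ?M)"
      unfolding z_def power_mult_distrib unity_root_power_N[OF M] by simp
    define S where "S = (\<Sum>j<?M. unity_root ?M k ^ j *\<^sub>C v j)"
    have S: "S = (\<Sum>j<?M. z ^ j *\<^sub>C (real j *\<^sub>R (V ^^ j) (B x)))"
      unfolding S_def v_def z_def
      by (intro sum.cong refl) (simp add: scaleR_scaleC[where 'a='a] scaleC_scaleC power_mult_distrib mult_ac)
    have U: "(\<Sum>j<?M. unity_root ?M k ^ j *\<^sub>C u j)
        = (\<Sum>j<?M. z ^ j *\<^sub>C (V ^^ j) x) - x - real N *\<^sub>R (z ^ ?M *\<^sub>C (V ^^ ?M) x)"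
      unfolding sum.lessThan_Suc_shift zM
      by (simp add: u_def z_def scaleR_scaleC[where 'a='a] scaleC_scaleC power_mult_distrib mult_ac del: funpow.simps)
    have "B (\<Sum>j<?M. unity_root ?M k ^ j *\<^sub>C u j)
        = (\<Sum>j<?M. z ^ j *\<^sub>C (V ^^ j) (B x)) - B x - real N *\<^sub>R (z ^ ?M *\<^sub>C (V ^^ ?M) (B x))"
      unfolding U by (simp add: B.diff B.sum B.scaleR bounded_clinear_scaleC[OF B] commn del: funpow.simps sum.lessThan_Suc)
    also have "\<dots> = S - z *\<^sub>C V S"
      unfolding S by (rule telescope_index_sum[OF V, symmetric])
    finally have "P z (B (\<Sum>j<?M. unity_root ?M k ^ j *\<^sub>C u j)) = S" using P[OF z] by simp
    then show ?thesis using PB[OF z] unfolding S_def by metis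
  qed
  have ub: "(norm ((V ^^ j) x))\<^sup>2 \<le> K\<^sup>2 * (norm x)\<^sup>2" for j
    using power_mono[OF Vbd[of j x], of 2] by (simp add: power_mult_distrib)
  have "real ?M * (\<Sum>j<?M. (norm (v j))\<^sup>2) = (\<Sum>k<?M. (norm (\<Sum>j<?M. unity_root ?M k ^ j *\<^sub>C v j))\<^sup>2)"
    by (rule parseval_DFT[OF M, symmetric])
  also have "\<dots> \<le> (\<Sum>k<?M. (b * norm (\<Sum>j<?M. unity_root ?M k ^ j *\<^sub>C u j))\<^sup>2)"
    by (intro sum_mono power_mono vhat) simp
  also have "\<dots> = b\<^sup>2 * (real ?M * (\<Sum>j<?M. (norm (u j))\<^sup>2))"
    unfolding power_mult_distrib sum_distrib_left[symmetric] parseval_DFT[OF M] ..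
  finally have "(\<Sum>j<?M. (norm (v j))\<^sup>2) \<le> b\<^sup>2 * (\<Sum>j<?M. (norm (u j))\<^sup>2)"
    by (simp add: mult.left_commute[of "b\<^sup>2"] del: sum.lessThan_Suc of_nat_Suc)
  also have "(\<Sum>j<?M. (norm (u j))\<^sup>2) \<le> K\<^sup>2 * (norm x)\<^sup>2 * (1 / (1 - r) + (real N * r ^ ?M)\<^sup>2)"
  proof -
    have "(\<Sum>j<?M. (norm (u j))\<^sup>2)
        = (real N * r ^ ?M)\<^sup>2 * (norm ((V ^^ ?M) x))\<^sup>2 + (\<Sum>j<N. (r ^ Suc j)\<^sup>2 * (norm ((V ^^ Suc j) x))\<^sup>2)"
      unfolding sum.lessThan_Suc_shift using r
      by (simp add: u_def power_mult_distrib del: funpow.simps)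
    also have "\<dots> \<le> (real N * r ^ ?M)\<^sup>2 * (K\<^sup>2 * (norm x)\<^sup>2) + (\<Sum>j<N. r ^ j * (K\<^sup>2 * (norm x)\<^sup>2))"
    proof (intro add_mono sum_mono mult_mono ub)
      fix j
      have "(r ^ Suc j)\<^sup>2 = r ^ j * r ^ (j + 2)" by (simp add: power2_eq_square)
      also have "\<dots> \<le> r ^ j * 1" using r by (intro mult_left_mono power_le_one) auto
      finally show "(r ^ Suc j)\<^sup>2 \<le> r ^ j" by simp
    qed (use r in auto)
    also have "(\<Sum>j<N. r ^ j * (K\<^sup>2 * (norm x)\<^sup>2)) \<le> 1 / (1 - r) * (K\<^sup>2 * (norm x)\<^sup>2)"
      unfolding sum_distrib_right[symmetric] using r
      by (intro mult_right_mono) (auto simp: sum_gp_strict divide_right_mono)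
    finally show ?thesis by (simp add: algebra_simps)
  qed
  finally have "(\<Sum>j<?M. (norm (v j))\<^sup>2) \<le> b\<^sup>2 * (K\<^sup>2 * (norm x)\<^sup>2 * (1 / (1 - r) + (real N * r ^ ?M)\<^sup>2))"
    by (simp add: mult_left_mono)
  moreover have "(norm (v j))\<^sup>2 = (real j)\<^sup>2 * r ^ (2 * j) * (norm ((V ^^ j) (B x)))\<^sup>2" for j
    using r by (simp add: v_def power_mult_distrib power_mult[symmetric] mult.commute)
  ultimately show ?thesis by (simp add: lessThan_Suc_atMost mult.assoc)
qed

text \<open>
  For large \<open>N\<close> the boundary term in \<open>weighted_orbit_sum_le\<close> is at most \<open>1\<close>, and \<open>1 / (1 - r) = n + 1\<close>. On the
  other side, \<open>V\<^sup>n B x\<close> is bounded by \<open>K\<close> times each earlier \<open>V\<^sup>j B x\<close>, so the sum of the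
  first \<open>n\<close> terms is at least a multiple of \<open>n\<^sup>3 (norm (V\<^sup>n B x))\<^sup>2\<close>.
\<close>
lemma power_bounded_decay:
  fixes V B :: "'a::complex_inner \<Rightarrow> 'a" and P :: "complex \<Rightarrow> 'a \<Rightarrow> 'a"
  assumes V: "bounded_clinear V" and B: "bounded_clinear B"
    and comm: "\<And>x. B (V x) = V (B x)"
    and Vbd: "\<And>n x. norm ((V ^^ n) x) \<le> K * norm x" and K: "K \<ge> 0"
    and n: "n > 0" and r: "r = real n / real (Suc n)"
    and P: "\<And>z x. cmod z = r \<Longrightarrow> P z (x - z *\<^sub>C V x) = x"
    and PB: "\<And>z x. cmod z = r \<Longrightarrow> norm (P z (B x)) \<le> b * norm x" and b: "b \<ge> 0"
  shows "norm ((V ^^ n) (B x)) \<le> 9 * K\<^sup>2 * b / real n * norm x"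
proof -
  have r01: "0 < r" "r < 1" using n by (auto simp: r field_simps)
  have "(\<lambda>N. real N * r ^ N) \<longlonglongrightarrow> 0"
    using r01 by (intro powser_times_n_limit_0) auto
  then have "\<forall>\<^sub>F N in sequentially. real N * r ^ N < 1 \<and> n \<le> N"
    by (intro eventually_conj eventually_ge_at_top order_tendstoD(2)) auto
  \<comment> \<open>The length of the transform may be as large as is convenient, which makes its boundary term
    harmless.\<close>
  then obtain N where N: "real N * r ^ N < 1" "n \<le> N"
    by (auto simp: eventually_sequentially)
  have "real N * r ^ Suc N \<le> real N * r ^ N"
    using r01 by (intro mult_left_mono) (auto intro: power_decreasing)
  then have N1: "(real N * r ^ Suc N)\<^sup>2 \<le> 1"
    using N r01 by (intro power_le_one) auto
  let ?a = "norm ((V ^^ n) (B x))"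
  have "real n ^ 3 / 3 * (1 / 9 * ?a\<^sup>2) \<le> (\<Sum>j\<le>n. (real j)\<^sup>2) * (1 / 9 * ?a\<^sup>2)"
    by (intro mult_right_mono sum_squares_ge) auto
  also have "\<dots> \<le> (\<Sum>j\<le>n. (real j)\<^sup>2 * (r ^ (2 * j) * (K * norm ((V ^^ j) (B x)))\<^sup>2))"
    unfolding sum_distrib_right
  proof (intro sum_mono mult_left_mono mult_mono)
    fix j assume j: "j \<in> {..n}"
    have "1 / 9 \<le> r ^ (2 * n)" unfolding r by (rule root_near_one_power_ge[OF n])
    also have "\<dots> \<le> r ^ (2 * j)" using r01 j by (intro power_decreasing) auto
    finally show "1 / 9 \<le> r ^ (2 * j)" .
    have "(V ^^ n) (B x) = (V ^^ (n - j)) ((V ^^ j) (B x))"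
      using j by (metis atMost_iff comp_apply funpow_add le_add_diff_inverse2)
    then show "?a\<^sup>2 \<le> (K * norm ((V ^^ j) (B x)))\<^sup>2"
      using Vbd by (intro power_mono) auto
  qed (use r01 in auto)
  also have "\<dots> = K\<^sup>2 * (\<Sum>j\<le>n. (real j)\<^sup>2 * r ^ (2 * j) * (norm ((V ^^ j) (B x)))\<^sup>2)"
    by (simp add: sum_distrib_left power_mult_distrib mult_ac)
  also have "\<dots> \<le> K\<^sup>2 * (\<Sum>j\<le>N. (real j)\<^sup>2 * r ^ (2 * j) * (norm ((V ^^ j) (B x)))\<^sup>2)"
    using N(2) r01 by (intro mult_left_mono sum_mono2) auto
  also have "\<dots> \<le> K\<^sup>2 * (b\<^sup>2 * K\<^sup>2 * (norm x)\<^sup>2 * (1 / (1 - r) + (real N * r ^ Suc N)\<^sup>2))"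
    by (intro mult_left_mono weighted_orbit_sum_le[OF V B comm Vbd r01 P PB]) auto
  also have "\<dots> \<le> K\<^sup>2 * (b\<^sup>2 * K\<^sup>2 * (norm x)\<^sup>2 * (3 * real n))"
  proof -
    have "1 / (1 - r) = real n + 1" by (simp add: r field_simps)
    moreover have "real n \<ge> 1" using n by simp
    ultimately show ?thesis using N1 by (intro mult_left_mono) auto
  qed
  finally have "real n * (real n * ?a)\<^sup>2 \<le> real n * (9 * K\<^sup>2 * b * norm x)\<^sup>2"
    by (simp add: power_mult_distrib power2_eq_square power3_eq_cube mult_ac)
  then have "(real n * ?a)\<^sup>2 \<le> (9 * K\<^sup>2 * b * norm x)\<^sup>2" using n by simp
  then have "real n * ?a \<le> 9 * K\<^sup>2 * b * norm x"
    by (rule power2_le_imp_le) (use b in auto)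
  then show ?thesis using n by (simp add: field_simps)
qed

section \<open>Integrals of continuous vector-valued functions\<close>

lemma exp_decay_integral:
  fixes a c :: real assumes "a > 0" "m \<le> n"
  shows "((\<lambda>s. c * exp (- (a * s))) has_integral (c / a * (exp (- (a * m)) - exp (- (a * n))))) {m..n}"
proof -
  have "((\<lambda>s. c * exp (- (a * s))) has_integral
      ((- c / a * exp (- (a * n))) - (- c / a * exp (- (a * m))))) {m..n}"
    by (rule fundamental_theorem_of_calculus[OF assms(2)])
      (use assms(1) in \<open>auto intro!: derivative_eq_intros simp: has_real_derivative_iff_has_vector_derivative[symmetric]\<close>)
  then show ?thesis by (simp add: algebra_simps)
qed

text \<open>
  The values lie in a Banach space that need not be separable. The integral over the half-line is
  therefore taken as a limit of integrals over bounded intervals, which exist by continuity.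
\<close>
lemma exp_decay_improper_integral:
  fixes f :: "real \<Rightarrow> 'b::banach"
  assumes f: "continuous_on {0..} f" and a: "a > 0"
    and bd: "\<And>s. s \<ge> 0 \<Longrightarrow> norm (f s) \<le> c * exp (- (a * s))"
  shows "\<exists>l. ((\<lambda>L. integral {0..L} f) \<longlongrightarrow> l) at_top \<and> norm l \<le> c / a"
proof -
  have c: "c \<ge> 0" using order_trans[OF norm_ge_zero bd[of 0]] by simp
  have int: "f integrable_on {m..n}" if "0 \<le> m" for m n
    using that by (intro integrable_continuous_real continuous_on_subset[OF f]) auto
  have diff: "norm (integral {0..n} f - integral {0..m} f) \<le> c / a * exp (- (a * m))"
    if "0 \<le> m" "m \<le> n" for m n
  proof -
    have "integral {0..n} f - integral {0..m} f = integral {m..n} f"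
      using Henstock_Kurzweil_Integration.integral_combine[of 0 m n f] that int[of 0 n] by (simp add: algebra_simps)
    also have "norm \<dots> \<le> integral {m..n} (\<lambda>s. c * exp (- (a * s)))"
      using that exp_decay_integral[OF a, of m n c]
      by (intro Henstock_Kurzweil_Integration.integral_norm_bound_integral int bd) (auto simp: has_integral_iff)
    also have "\<dots> = c / a * (exp (- (a * m)) - exp (- (a * n)))"
      using exp_decay_integral[OF a that(2)] by (rule integral_unique)
    also have "\<dots> \<le> c / a * exp (- (a * m))" using a c by (intro mult_left_mono) auto
    finally show ?thesis .
  qed
  have lim0: "((\<lambda>m. c / a * exp (- (a * m))) \<longlongrightarrow> 0) at_top"
  proof -
    have "filterlim (\<lambda>m. - (a * m)) at_bot at_top"
      unfolding filterlim_uminus_at_top[symmetric]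
      by (rule filterlim_tendsto_pos_mult_at_top[OF tendsto_const a filterlim_ident])
    from filterlim_compose[OF exp_at_bot this] show ?thesis by (intro tendsto_mult_right_zero)
  qed
  have "Cauchy (\<lambda>n. integral {0..real n} f)"
  proof (rule metric_CauchyI)
    fix e :: real assume "e > 0"
    then have "\<forall>\<^sub>F n in sequentially. c / a * exp (- (a * real n)) < e"
      by (rule order_tendstoD(2)[OF filterlim_compose[OF lim0 filterlim_real_sequentially]])
    then obtain M where M: "\<And>n. n \<ge> M \<Longrightarrow> c / a * exp (- (a * real n)) < e"
      by (auto simp: eventually_sequentially)
    show "\<exists>M. \<forall>m\<ge>M. \<forall>n\<ge>M. dist (integral {0..real m} f) (integral {0..real n} f) < e"
    proof (intro exI allI impI)
      fix m n assume mn: "M \<le> m" "M \<le> n"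
      show "dist (integral {0..real m} f) (integral {0..real n} f) < e"
      proof (cases "m \<le> n")
        case True then show ?thesis using diff[of "real m" "real n"] M[OF mn(1)] by (simp add: dist_norm norm_minus_commute)
      next
        case False then show ?thesis using diff[of "real n" "real m"] M[OF mn(2)] by (simp add: dist_norm)
      qed
    qed
  qed
  then obtain l where l: "(\<lambda>n. integral {0..real n} f) \<longlonglongrightarrow> l"
    using Cauchy_convergent convergentD by blast
  have lb: "norm (l - integral {0..m} f) \<le> c / a * exp (- (a * m))" if m: "0 \<le> m" for m
  proof (rule Lim_norm_ubound[OF sequentially_bot])
    show "(\<lambda>n. integral {0..real n} f - integral {0..m} f) \<longlonglongrightarrow> l - integral {0..m} f"
      by (intro tendsto_intros l)
    have "\<forall>\<^sub>F n in sequentially. m \<le> real n"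
      using filterlim_real_sequentially by (simp add: filterlim_at_top)
    then show "\<forall>\<^sub>F n in sequentially. norm (integral {0..real n} f - integral {0..m} f) \<le> c / a * exp (- (a * m))"
      by eventually_elim (rule diff[OF m])
  qed
  have "((\<lambda>m. integral {0..m} f - l) \<longlongrightarrow> 0) at_top"
    by (rule Lim_null_comparison[OF _ lim0], rule eventually_mono[OF eventually_ge_at_top[of 0]])
      (metis lb norm_minus_commute)
  then show ?thesis using lb[of 0] by (auto simp: LIM_zero_iff)
qed

lemma at_right_quotient_integral:
  fixes f :: "real \<Rightarrow> 'b::banach"
  assumes f: "continuous_on {0..} f"
  shows "((\<lambda>h. integral {0..h} f /\<^sub>R h) \<longlongrightarrow> f 0) (at_right 0)"
proof -
  have "((\<lambda>u. integral {0..u} f) has_vector_derivative f 0) (at 0 within {0..1})"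
    by (intro integral_has_vector_derivative continuous_on_subset[OF f]) auto
  then have "((\<lambda>y. (integral {0..y} f - y *\<^sub>R f 0) /\<^sub>R \<bar>y\<bar>) \<longlongrightarrow> 0) (at_right 0)"
    by (simp add: has_vector_derivative_def has_derivative_at_within at_within_Icc_at_right)
  then have "((\<lambda>y. integral {0..y} f /\<^sub>R y - f 0) \<longlongrightarrow> 0) (at_right 0)"
    by (rule Lim_transform_eventually)
      (auto intro!: eventually_at_rightI[of 0 1] simp: algebra_simps)
  then show ?thesis by (simp add: LIM_zero_iff)
qed

lemma at_right_quotient_exp: "((\<lambda>h. (exp (z * complex_of_real h) - 1) / complex_of_real h) \<longlongrightarrow> z) (at_right 0)"
proof -
  have "((\<lambda>h. exp (z * h)) has_field_derivative z) (at 0)"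
    by (auto intro!: derivative_eq_intros)
  then have "((\<lambda>h. (exp (z * h) - 1) / h) \<longlongrightarrow> z) (at 0)"
    by (simp add: DERIV_def)
  moreover have "filterlim complex_of_real (at 0) (at_right 0)"
    unfolding filterlim_at using tendsto_of_real[OF tendsto_ident_at, of 0 "{0<..}", where 'a=complex]
    by (auto intro!: eventually_at_rightI[of 0 1])
  ultimately show ?thesis by (rule filterlim_compose)
qed

section \<open>Resolvents\<close>

text \<open>
  \<open>S\<close> is the inverse of \<open>z + A\<close>, rather than of \<open>z - A\<close>, in accordance with \<open>- A\<close> being the
  generator.
\<close>
definition is_resolvent :: "'a::complex_inner set \<Rightarrow> ('a \<Rightarrow> 'a) \<Rightarrow> complex \<Rightarrow> ('a \<Rightarrow> 'a) \<Rightarrow> bool"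
  where "is_resolvent D A z S \<longleftrightarrow> bounded_clinear S \<and>
    (\<forall>x. S x \<in> D \<and> z *\<^sub>C S x + A (S x) = x) \<and> (\<forall>x\<in>D. S (z *\<^sub>C x + A x) = x)"

lemma is_resolvent_inv_into:
  assumes "is_resolvent D A z S"
  shows "inv_into D (\<lambda>x. z *\<^sub>C x + A x) = S"
proof
  fix x
  have "inj_on (\<lambda>x. z *\<^sub>C x + A x) D"
    using assms unfolding is_resolvent_def by (intro inj_onI) (metis (no_types))
  moreover have "S x \<in> D" "z *\<^sub>C S x + A (S x) = x"
    using assms by (auto simp: is_resolvent_def)
  ultimately show "inv_into D (\<lambda>x. z *\<^sub>C x + A x) x = S x"
    using inv_into_f_f[of "\<lambda>x. z *\<^sub>C x + A x" D "S x"] by simp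
qed

lemma resolvent_identity:
  assumes "is_resolvent D A z S" "is_resolvent D A w Q"
  shows "S x - Q x = (w - z) *\<^sub>C S (Q x)"
proof -
  interpret S: bounded_linear S
    using assms by (auto simp: is_resolvent_def bounded_clinear_linear)
  have "S (w *\<^sub>C Q x + A (Q x)) = S x" "S (z *\<^sub>C Q x + A (Q x)) = Q x"
    using assms by (auto simp: is_resolvent_def)
  then have "S x - Q x = S ((w *\<^sub>C Q x + A (Q x)) - (z *\<^sub>C Q x + A (Q x)))"
    by (simp only: S.diff)
  also have "\<dots> = S ((w - z) *\<^sub>C Q x)" by (simp add: scaleC_diff_left)
  finally show ?thesis using assms by (simp add: is_resolvent_def bounded_clinear_scaleC)
qed

lemma is_resolvent_of_resolvent_set:
  assumes "- z \<in> resolvent_set D A"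
  shows "is_resolvent D A z (inv_into D (\<lambda>x. z *\<^sub>C x + A x))"
proof -
  let ?f = "\<lambda>x. - z *\<^sub>C x - A x" and ?g = "\<lambda>x. z *\<^sub>C x + A x"
  have bij: "bij_betw ?f D UNIV" and cl: "bounded_clinear (inv_into D ?f)"
    using assms by (auto simp: resolvent_set_def)
  interpret F: bounded_linear "inv_into D ?f" using cl by (rule bounded_clinear_linear)
  have fg: "?f x = - ?g x" for x by (simp add: scaleC_minus_left)
  have surj: "\<exists>x\<in>D. ?g x = y" for y
  proof -
    have "- y \<in> ?f ` D" using bij_betw_imp_surj_on[OF bij] by simp
    then obtain x where x: "x \<in> D" "- y = ?f x" by blast
    then have "?g x = y" unfolding fg by (simp only: neg_equal_iff_equal)
    then show ?thesis using x by blast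
  qed
  have im: "y \<in> ?g ` D" for y using surj[of y] by auto
  have inj: "inj_on ?g D"
    using bij_betw_imp_inj_on[OF bij] unfolding fg by (simp only: inj_on_def neg_equal_iff_equal)
  have eq: "inv_into D ?g y = - inv_into D ?f y" for y
  proof -
    obtain x where x: "x \<in> D" "?g x = y" using surj by blast
    have "inv_into D ?f (- y) = x"
      using inv_into_f_f[OF bij_betw_imp_inj_on[OF bij] x(1)] unfolding fg x(2) .
    moreover have "inv_into D ?g y = x" using inv_into_f_f[OF inj x(1)] unfolding x(2) .
    ultimately show ?thesis using linear_neg[OF F.linear, of y] by simp
  qed
  have "bounded_clinear (inv_into D ?g)"
    unfolding eq[abs_def] bounded_clinear_def
    using cl bounded_linear_minus[OF F.bounded_linear_axioms]
    by (simp add: bounded_clinear_scaleC scaleC_right_simps)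
  then show ?thesis
    unfolding is_resolvent_def using inv_into_into[OF im] f_inv_into_f[OF im] inv_into_f_f[OF inj]
    by simp
qed

section \<open>Bounded semigroups and the Laplace transform\<close>

locale bounded_C0_semigroup =
  fixes T :: "real \<Rightarrow> 'a::chilbert_space \<Rightarrow> 'a" and D :: "'a set" and A :: "'a \<Rightarrow> 'a" and K :: real
  assumes C0: "C0_semigroup T" and gen: "is_generator T D (\<lambda>x. - A x)"
    and norm_T: "t \<ge> 0 \<Longrightarrow> norm (T t x) \<le> K * norm x" and K_ge_1: "1 \<le> K"
begin

lemma K_pos: "K > 0" using K_ge_1 by simp

lemma T_clinear: "t \<ge> 0 \<Longrightarrow> bounded_clinear (T t)"
  and T_0: "T 0 x = x"
  and T_add: "s \<ge> 0 \<Longrightarrow> t \<ge> 0 \<Longrightarrow> T (s + t) x = T s (T t x)"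
  and T_right_0: "((\<lambda>t. T t x) \<longlongrightarrow> x) (at_right 0)"
  using C0 by (auto simp: C0_semigroup_def)

lemma T_linear: "t \<ge> 0 \<Longrightarrow> bounded_linear (T t)"
  by (rule bounded_clinear_linear[OF T_clinear])

lemma T_diff: "t \<ge> 0 \<Longrightarrow> T t (x - y) = T t x - T t y"
  by (rule linear_diff[OF bounded_linear.linear[OF T_linear]])

lemma T_commute: "s \<ge> 0 \<Longrightarrow> t \<ge> 0 \<Longrightarrow> T s (T t x) = T t (T s x)"
  using T_add[of s t x] T_add[of t s x] by (simp add: add.commute)

text \<open>
  Strong continuity at \<open>0\<close> and the uniform bound thus give continuity at every point, from both sides.
\<close>
lemma norm_T_diff:
  assumes "0 \<le> s" "0 \<le> t"
  shows "norm (T t x - T s x) \<le> K * norm (T \<bar>t - s\<bar> x - x)"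
proof -
  have *: "norm (T t x - T s x) \<le> K * norm (T (t - s) x - x)" if "0 \<le> s" "s \<le> t" for s t
  proof -
    have "T t x - T s x = T s (T (t - s) x - x)"
      using that T_add[of s "t - s" x] by (simp add: T_diff)
    then show ?thesis using that norm_T by simp
  qed
  show ?thesis
    using *[of s t] *[of t s] assms by (cases "s \<le> t") (auto simp: norm_minus_commute abs_if)
qed

lemma T_continuous: "continuous_on {0..} (\<lambda>t. T t x)"
  unfolding continuous_on_iff
proof (intro ballI allI impI)
  fix t e :: real assume t: "t \<in> {0..}" and e: "e > 0"
  have "\<forall>\<^sub>F h in at_right 0. dist (T h x) x < e / K"
    using T_right_0 e K_pos by (intro tendstoD) auto
  then obtain d where d: "d > 0" "\<And>h. 0 < h \<Longrightarrow> h < d \<Longrightarrow> dist (T h x) x < e / K"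
    by (auto simp: eventually_at_right_field)
  show "\<exists>d>0. \<forall>t'\<in>{0..}. dist t' t < d \<longrightarrow> dist (T t' x) (T t x) < e"
  proof (intro exI conjI ballI impI)
    fix t' :: real assume t': "t' \<in> {0..}" "dist t' t < d"
    have "norm (T \<bar>t' - t\<bar> x - x) < e / K"
      using d(2)[of "\<bar>t' - t\<bar>"] t' e K_pos by (cases "t' = t") (auto simp: dist_norm T_0)
    then have "K * norm (T \<bar>t' - t\<bar> x - x) < e" using K_pos by (simp add: field_simps)
    then show "dist (T t' x) (T t x) < e"
      using norm_T_diff[of t t' x] t t' by (simp add: dist_norm)
  qed (rule d)
qed

lemma generator_tendsto: "x \<in> D \<Longrightarrow> ((\<lambda>h. (T h x - x) /\<^sub>R h) \<longlongrightarrow> - A x) (at_right 0)"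
  using gen by (simp add: is_generator_def)

lemma generator_eqI:
  assumes "((\<lambda>h. (T h x - x) /\<^sub>R h) \<longlongrightarrow> y) (at_right 0)"
  shows "x \<in> D" "A x = - y"
proof -
  show D: "x \<in> D" using assms gen by (auto simp: is_generator_def)
  show "A x = - y"
    using tendsto_unique[OF _ generator_tendsto[OF D] assms] by auto
qed

text \<open>
  For \<open>Re z > 0\<close>, the integral of an orbit of the rescaled semigroup over the half-line, that is
  \<open>laplace z\<close>, is \<open>(z + A)\<^sup>-\<^sup>1\<close>; see \<open>is_resolvent_laplace\<close>.
\<close>
definition orbit :: "complex \<Rightarrow> 'a \<Rightarrow> real \<Rightarrow> 'a"
  where "orbit z x s = exp (- z * complex_of_real s) *\<^sub>C T s x"

definition laplace :: "complex \<Rightarrow> 'a \<Rightarrow> 'a"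
  where "laplace z x = Lim at_top (\<lambda>L. integral {0..L} (orbit z x))"

lemma orbit_continuous: "continuous_on {0..} (orbit z x)"
  unfolding orbit_def[abs_def]
  by (intro continuous_on_scaleC continuous_intros T_continuous)

lemma orbit_integrable: "0 \<le> a \<Longrightarrow> orbit z x integrable_on {a..b}"
  by (intro integrable_continuous_real continuous_on_subset[OF orbit_continuous]) auto

lemma norm_orbit: "norm (orbit z x s) = exp (- (Re z * s)) * norm (T s x)"
  by (simp add: orbit_def norm_scaleC)

text \<open>
  The constant \<open>c\<close> may depend on \<open>x\<close>: applied with the supremum of \<open>norm (T s x)\<close>, this makes
  \<open>Re z * laplace z\<close> a contraction for an equivalent norm.
\<close>
lemma laplace_exists:
  assumes z: "Re z > 0" and c: "\<And>s. s \<ge> 0 \<Longrightarrow> norm (T s x) \<le> c"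
  shows "((\<lambda>L. integral {0..L} (orbit z x)) \<longlongrightarrow> laplace z x) at_top \<and> norm (laplace z x) \<le> c / Re z"
proof -
  have "\<exists>l. ((\<lambda>L. integral {0..L} (orbit z x)) \<longlongrightarrow> l) at_top \<and> norm l \<le> c / Re z"
    by (rule exp_decay_improper_integral[OF orbit_continuous z])
      (simp add: norm_orbit c mult.commute mult_left_mono)
  then show ?thesis unfolding laplace_def using tendsto_Lim[OF trivial_limit_at_top_linorder] by blast
qed

lemmas laplace_tendsto = laplace_exists[OF _ norm_T, THEN conjunct1]
lemmas norm_laplace_le_bound = laplace_exists[THEN conjunct2]

lemma norm_laplace: "Re z > 0 \<Longrightarrow> norm (laplace z x) \<le> K / Re z * norm x"
  using norm_laplace_le_bound[OF _ norm_T, of z x] by simp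

lemma laplace_commute:
  assumes z: "Re z > 0" and B: "bounded_clinear B" and comm: "\<And>s x. s \<ge> 0 \<Longrightarrow> T s (B x) = B (T s x)"
  shows "laplace z (B x) = B (laplace z x)"
proof -
  have "integral {0..L} (orbit z (B x)) = B (integral {0..L} (orbit z x))" for L
  proof -
    have "integral {0..L} (orbit z (B x)) = integral {0..L} (B \<circ> orbit z x)"
      by (rule Henstock_Kurzweil_Integration.integral_cong)
        (simp add: orbit_def comm bounded_clinear_scaleC[OF B])
    also have "\<dots> = B (integral {0..L} (orbit z x))"
      by (intro integral_linear orbit_integrable bounded_clinear_linear[OF B]) simp
    finally show ?thesis .
  qed
  then have "((\<lambda>L. integral {0..L} (orbit z (B x))) \<longlongrightarrow> B (laplace z x)) at_top"
    using bounded_linear.tendsto[OF bounded_clinear_linear[OF B] laplace_tendsto[OF z, of x]] by simp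
  then show ?thesis using laplace_tendsto[OF z, of "B x"] tendsto_unique[OF trivial_limit_at_top_linorder] by blast
qed

lemma laplace_clinear:
  assumes z: "Re z > 0"
  shows "bounded_clinear (laplace z)"
proof -
  have add: "laplace z (x + y) = laplace z x + laplace z y" for x y
  proof -
    have "integral {0..L} (orbit z (x + y)) = integral {0..L} (orbit z x) + integral {0..L} (orbit z y)" for L
    proof -
      have "integral {0..L} (orbit z (x + y)) = integral {0..L} (\<lambda>s. orbit z x s + orbit z y s)"
        by (rule Henstock_Kurzweil_Integration.integral_cong)
          (simp add: orbit_def scaleC_add_right linear_add[OF bounded_linear.linear[OF T_linear]])
      then show ?thesis by (simp add: Henstock_Kurzweil_Integration.integral_add orbit_integrable)
    qed
    then have "((\<lambda>L. integral {0..L} (orbit z (x + y))) \<longlongrightarrow> laplace z x + laplace z y) at_top"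
      using tendsto_add[OF laplace_tendsto[OF z, of x] laplace_tendsto[OF z, of y]] by simp
    then show ?thesis using laplace_tendsto[OF z, of "x + y"] tendsto_unique[OF trivial_limit_at_top_linorder] by blast
  qed
  have scale: "laplace z (c *\<^sub>C x) = c *\<^sub>C laplace z x" for c x
    by (rule laplace_commute[OF z, where B = "\<lambda>x. c *\<^sub>C x"])
      (simp_all add: bounded_clinear_def bounded_linear_scaleC_right scaleC_scaleC mult.commute
        bounded_clinear_scaleC[OF T_clinear])
  have "bounded_linear (laplace z)"
    using norm_laplace[OF z]
    by (intro bounded_linear_intro[where K = "K / Re z"]) (auto simp: add scale scaleR_scaleC mult.commute)
  then show ?thesis by (simp add: bounded_clinear_def scale)
qed

lemma T_laplace: "s \<ge> 0 \<Longrightarrow> Re z > 0 \<Longrightarrow> T s (laplace z x) = laplace z (T s x)"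
  by (rule laplace_commute[symmetric]) (auto simp: T_clinear T_commute)

text \<open>
  Translation by \<open>k\<close> cuts off the integral over \<open>[0, k]\<close>. Differentiating at \<open>k = 0\<close> identifies
  \<open>laplace z\<close> as a resolvent; for a fixed \<open>k\<close> the same formula compares the resolvent with a truncated
  integral.
\<close>
lemma T_laplace_shift:
  assumes k: "k \<ge> 0" and z: "Re z > 0"
  shows "T k (laplace z x) = exp (z * complex_of_real k) *\<^sub>C (laplace z x - integral {0..k} (orbit z x))"
proof -
  let ?E = "exp (z * complex_of_real k)"
  have eq: "integral {0..L} (orbit z (T k x)) = ?E *\<^sub>C (integral {0..L + k} (orbit z x) - integral {0..k} (orbit z x))"
    if L: "L \<ge> 0" for L
  proof -
    have "(orbit z x has_integral integral {k..L + k} (orbit z x)) (cbox k (L + k))"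
      using orbit_integrable[OF k] by (simp add: integrable_integral)
    from has_integral_affinity'[OF this, of 1 k]
    have "((\<lambda>s. orbit z x (s + k)) has_integral integral {k..L + k} (orbit z x)) {0..L}" by simp
    then have "((\<lambda>s. ?E *\<^sub>C orbit z x (s + k)) has_integral ?E *\<^sub>C integral {k..L + k} (orbit z x)) {0..L}"
      using has_integral_linear[OF _ bounded_linear_scaleC_right[of ?E]] by (simp add: o_def)
    moreover have "?E *\<^sub>C orbit z x (s + k) = orbit z (T k x) s" if "s \<in> {0..L}" for s
      using that k T_add[of s k x]
      by (simp add: orbit_def scaleC_scaleC exp_add[symmetric] ring_distribs)
    ultimately have "(orbit z (T k x) has_integral ?E *\<^sub>C integral {k..L + k} (orbit z x)) {0..L}"
      by (rule has_integral_eq[rotated]) simp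
    moreover have "integral {0..k} (orbit z x) + integral {k..L + k} (orbit z x) = integral {0..L + k} (orbit z x)"
      using k L orbit_integrable by (intro Henstock_Kurzweil_Integration.integral_combine) auto
    ultimately show ?thesis by (simp add: integral_unique eq_diff_eq[symmetric] add.commute[of "integral {0..k} (orbit z x)"])
  qed
  have "((\<lambda>L. ?E *\<^sub>C (integral {0..L + k} (orbit z x) - integral {0..k} (orbit z x)))
      \<longlongrightarrow> ?E *\<^sub>C (laplace z x - integral {0..k} (orbit z x))) at_top"
    by (intro tendsto_scaleC tendsto_diff tendsto_const filterlim_compose[OF laplace_tendsto[OF z]]
        filterlim_tendsto_add_at_top[OF tendsto_const filterlim_ident, of k, unfolded add.commute[of k]])
  then have "((\<lambda>L. integral {0..L} (orbit z (T k x))) \<longlongrightarrow> ?E *\<^sub>C (laplace z x - integral {0..k} (orbit z x))) at_top"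
    by (rule Lim_transform_eventually) (auto intro!: eventually_mono[OF eventually_ge_at_top[of 0]] simp: eq)
  then show ?thesis
    using tendsto_unique[OF trivial_limit_at_top_linorder laplace_tendsto[OF z, of "T k x"]] T_laplace[OF k z, of x] by simp
qed

lemma laplace_generator_tendsto:
  assumes z: "Re z > 0"
  shows "((\<lambda>h. (T h (laplace z x) - laplace z x) /\<^sub>R h) \<longlongrightarrow> z *\<^sub>C laplace z x - x) (at_right 0)"
proof -
  let ?E = "\<lambda>h. exp (z * complex_of_real h)"
  have "((\<lambda>h. ((?E h - 1) / complex_of_real h) *\<^sub>C laplace z x - ?E h *\<^sub>C (integral {0..h} (orbit z x) /\<^sub>R h))
      \<longlongrightarrow> z *\<^sub>C laplace z x - exp (z * complex_of_real 0) *\<^sub>C orbit z x 0) (at_right 0)"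
    by (intro tendsto_diff tendsto_scaleC tendsto_const at_right_quotient_exp
        at_right_quotient_integral orbit_continuous tendsto_intros)
  moreover have "\<forall>\<^sub>F h in at_right 0. ((?E h - 1) / complex_of_real h) *\<^sub>C laplace z x - ?E h *\<^sub>C (integral {0..h} (orbit z x) /\<^sub>R h)
      = (T h (laplace z x) - laplace z x) /\<^sub>R h"
  proof (intro eventually_at_rightI[of 0 1])
    fix h :: real assume "h \<in> {0<..<1}"
    then show "((?E h - 1) / complex_of_real h) *\<^sub>C laplace z x - ?E h *\<^sub>C (integral {0..h} (orbit z x) /\<^sub>R h)
      = (T h (laplace z x) - laplace z x) /\<^sub>R h"
      by (simp add: T_laplace_shift[OF _ z] scaleR_scaleC[where 'a='a] scaleC_scaleC scaleC_right_simps scaleC_diff_left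
          divide_inverse ring_distribs mult_ac)
  qed simp
  ultimately have "((\<lambda>h. (T h (laplace z x) - laplace z x) /\<^sub>R h)
      \<longlongrightarrow> z *\<^sub>C laplace z x - exp (z * complex_of_real 0) *\<^sub>C orbit z x 0) (at_right 0)"
    by (rule Lim_transform_eventually)
  then show ?thesis by (simp add: orbit_def T_0)
qed

text \<open>
  That \<open>laplace z\<close> is also a left inverse follows from the limit in the preceding lemma, since
  \<open>laplace z\<close> is continuous and commutes with the difference quotients of \<open>T\<close>.
\<close>
lemma is_resolvent_laplace:
  assumes z: "Re z > 0"
  shows "is_resolvent D A z (laplace z)"
  unfolding is_resolvent_def
proof (intro conjI allI ballI)
  interpret L: bounded_linear "laplace z" by (rule bounded_clinear_linear[OF laplace_clinear[OF z]])
  show "bounded_clinear (laplace z)" by (rule laplace_clinear[OF z])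
  fix x
  note * = generator_eqI[OF laplace_generator_tendsto[OF z, of x]]
  show "laplace z x \<in> D" "z *\<^sub>C laplace z x + A (laplace z x) = x" using * by simp_all
next
  fix x assume x: "x \<in> D"
  interpret L: bounded_linear "laplace z" by (rule bounded_clinear_linear[OF laplace_clinear[OF z]])
  have "((\<lambda>h. laplace z ((T h x - x) /\<^sub>R h)) \<longlongrightarrow> laplace z (- A x)) (at_right 0)"
    by (rule L.tendsto[OF generator_tendsto[OF x]])
  then have "((\<lambda>h. (T h (laplace z x) - laplace z x) /\<^sub>R h) \<longlongrightarrow> laplace z (- A x)) (at_right 0)"
    by (rule Lim_transform_eventually)
      (auto intro!: eventually_at_rightI[of 0 1] simp: L.scaleR L.diff T_laplace[OF _ z])
  then have "laplace z (- A x) = z *\<^sub>C laplace z x - x"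
    using laplace_generator_tendsto[OF z, of x] by (intro tendsto_unique) auto
  then show "laplace z (z *\<^sub>C x + A x) = x"
    by (simp add: L.add linear_neg[OF L.linear] bounded_clinear_scaleC[OF laplace_clinear[OF z]] algebra_simps)
qed

text \<open>
  The means of an orbit over \<open>[0, k]\<close> converge to its initial point, and the shift formula expresses
  them through values of \<open>laplace 1\<close>.
\<close>
lemma D_dense:
  assumes "e > 0"
  shows "\<exists>y\<in>D. norm (y - x) < e"
proof -
  have D_diff: "u - v \<in> D" if "u \<in> D" "v \<in> D" for u v
  proof -
    have "((\<lambda>h. (T h u - u) /\<^sub>R h - (T h v - v) /\<^sub>R h) \<longlongrightarrow> - A u - - A v) (at_right 0)"
      by (intro tendsto_diff generator_tendsto that)
    then have "((\<lambda>h. (T h (u - v) - (u - v)) /\<^sub>R h) \<longlongrightarrow> - A u - - A v) (at_right 0)"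
      by (rule Lim_transform_eventually)
        (auto intro!: eventually_at_rightI[of 0 1] simp: T_diff algebra_simps)
    then show ?thesis by (rule generator_eqI)
  qed
  have laplace_D: "laplace 1 y \<in> D" for y
    using is_resolvent_laplace[of 1] by (simp add: is_resolvent_def)
  have in_D: "integral {0..k} (orbit 1 x) /\<^sub>R k \<in> D" if k: "k > 0" for k
  proof -
    have "exp (- complex_of_real k) *\<^sub>C T k (laplace 1 x) = laplace 1 x - integral {0..k} (orbit 1 x)"
      using k by (simp add: T_laplace_shift scaleC_scaleC exp_add[symmetric])
    then have I: "integral {0..k} (orbit 1 x) = laplace 1 x - exp (- complex_of_real k) *\<^sub>C T k (laplace 1 x)" by simp
    have "integral {0..k} (orbit 1 x) /\<^sub>R k
        = laplace 1 (complex_of_real (inverse k) *\<^sub>C x) - laplace 1 (complex_of_real (inverse k) *\<^sub>C exp (- complex_of_real k) *\<^sub>C T k x)"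
      unfolding I using k
      by (simp add: T_laplace scaleR_scaleC[where 'a='a] bounded_clinear_scaleC[OF laplace_clinear] scaleC_right_simps)
    then show ?thesis using D_diff[OF laplace_D laplace_D] by simp
  qed
  have "((\<lambda>k. integral {0..k} (orbit 1 x) /\<^sub>R k) \<longlongrightarrow> x) (at_right 0)"
    using at_right_quotient_integral[OF orbit_continuous, of 1 x] by (simp add: orbit_def T_0)
  then have "\<forall>\<^sub>F k in at_right 0. dist (integral {0..k} (orbit 1 x) /\<^sub>R k) x < e"
    using assms by (rule tendstoD)
  then obtain d where "d > 0" "\<And>k. 0 < k \<Longrightarrow> k < d \<Longrightarrow> dist (integral {0..k} (orbit 1 x) /\<^sub>R k) x < e"
    by (auto simp: eventually_at_right_field)
  from in_D[of "d/2"] this(2)[of "d/2"] \<open>d > 0\<close> show ?thesis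
    by (intro bexI[of _ "integral {0..d/2} (orbit 1 x) /\<^sub>R (d/2)"]) (auto simp: dist_norm)
qed

section \<open>The implicit Euler scheme\<close>

text \<open>
  One step of length \<open>h\<close> of the implicit Euler scheme for \<open>u' = - A u\<close>, that is \<open>(1 + h A)\<^sup>-\<^sup>1\<close>.
\<close>
definition euler_step :: "real \<Rightarrow> 'a \<Rightarrow> 'a"
  where "euler_step h x = laplace (complex_of_real (1 / h)) x /\<^sub>R h"

lemma euler_eq: "euler_step h x = complex_of_real (1 / h) *\<^sub>C laplace (complex_of_real (1 / h)) x"
  by (simp add: euler_step_def scaleR_scaleC divide_inverse)

lemma euler_clinear: "h > 0 \<Longrightarrow> bounded_clinear (euler_step h)"
proof -
  assume h: "h > 0"
  have L: "bounded_clinear (laplace (complex_of_real (1 / h)))" using h by (intro laplace_clinear) simp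
  from bounded_linear_compose[OF bounded_linear_scaleC_right bounded_clinear_linear[OF this]]
  show ?thesis
    unfolding bounded_clinear_def euler_eq
    by (simp add: bounded_clinear_scaleC[OF L] scaleC_scaleC mult.commute del: of_real_divide)
qed

lemma T_euler: "h > 0 \<Longrightarrow> s \<ge> 0 \<Longrightarrow> T s (euler_step h x) = euler_step h (T s x)"
  by (simp add: euler_eq bounded_clinear_scaleC[OF T_clinear] T_laplace)

text \<open>
  A step does not increase \<open>sup {norm (T s x) | s \<ge> 0}\<close>, so the powers of a step stay bounded by
  \<open>K\<close>, and not by powers of \<open>K\<close>.
\<close>
lemma norm_T_euler_power:
  assumes h: "h > 0" and c: "\<And>s. s \<ge> 0 \<Longrightarrow> norm (T s x) \<le> c" and s: "s \<ge> 0"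
  shows "norm (T s ((euler_step h ^^ n) x)) \<le> c"
  using s
proof (induction n arbitrary: s)
  case (Suc n)
  let ?y = "(euler_step h ^^ n) x"
  have "norm (T s (euler_step h ?y)) = norm (laplace (complex_of_real (1 / h)) (T s ?y)) / h"
    using h Suc.prems by (simp add: T_euler) (simp add: euler_step_def divide_inverse mult.commute)
  also have "\<dots> \<le> (c / Re (complex_of_real (1 / h))) / h"
  proof (intro divide_right_mono norm_laplace_le_bound)
    fix s' :: real assume "s' \<ge> 0"
    then show "norm (T s' (T s ?y)) \<le> c" using Suc.IH[of "s' + s"] Suc.prems by (simp add: T_add)
  qed (use h in auto)
  also have "\<dots> = c" using h by simp
  finally show ?case by simp
qed (simp add: c)

lemma norm_euler_power: "h > 0 \<Longrightarrow> norm ((euler_step h ^^ n) x) \<le> K * norm x"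
  using norm_T_euler_power[of h x "K * norm x" 0 n] norm_T by (simp add: T_0)

lemma euler_power_linear: "h > 0 \<Longrightarrow> bounded_linear (euler_step h ^^ n)"
proof (induction n)
  case 0 then show ?case by (simp add: id_def bounded_linear_ident)
next
  case (Suc n)
  then show ?case
    using bounded_linear_compose[OF bounded_clinear_linear[OF euler_clinear], of h "euler_step h ^^ n"]
    by (simp add: o_def)
qed

lemma euler_diff_D:
  assumes "h > 0" "x \<in> D"
  shows "(euler_step h x - x) /\<^sub>R h = - euler_step h (A x)"
proof -
  let ?z = "complex_of_real (1 / h)"
  have r: "is_resolvent D A ?z (laplace ?z)" using assms by (intro is_resolvent_laplace) simp
  then interpret L: bounded_linear "laplace ?z" by (simp add: is_resolvent_def bounded_clinear_linear)
  have "laplace ?z (?z *\<^sub>C x + A x) = x" using r assms by (auto simp: is_resolvent_def)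
  then have "x = euler_step h x + h *\<^sub>R euler_step h (A x)"
    using assms(1) r unfolding euler_eq L.add is_resolvent_def
    by (simp add: bounded_clinear_scaleC scaleR_scaleC[where 'a='a] scaleC_scaleC)
  then have "euler_step h x - x = - (h *\<^sub>R euler_step h (A x))" by (simp add: algebra_simps)
  then show ?thesis using assms(1) by simp
qed

lemma euler_tendsto: "((\<lambda>h. euler_step h x) \<longlongrightarrow> x) (at_right 0)"
proof (rule tendstoI)
  fix e :: real assume e: "e > 0"
  define d where "d = e / 2 / (K + 1)"
  have d: "d > 0" using e K_pos by (simp add: d_def)
  obtain y where y: "y \<in> D" "norm (y - x) < d" using D_dense[OF d] by blast
  have "((\<lambda>h. h * (K * norm (A y))) \<longlongrightarrow> 0) (at_right 0)"
    by (auto intro!: tendsto_eq_intros)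
  then have "\<forall>\<^sub>F h in at_right 0. h * (K * norm (A y)) < e / 2"
    using e by (intro order_tendstoD(2)) auto
  moreover have "\<forall>\<^sub>F h in at_right (0::real). h > 0" by (rule eventually_at_right_less)
  ultimately show "\<forall>\<^sub>F h in at_right 0. dist (euler_step h x) x < e"
  proof eventually_elim
    case (elim h)
    interpret V: bounded_linear "euler_step h" using elim by (intro bounded_clinear_linear euler_clinear)
    have "euler_step h y - y = h *\<^sub>R ((euler_step h y - y) /\<^sub>R h)" using elim by simp
    also have "\<dots> = - (h *\<^sub>R euler_step h (A y))" unfolding euler_diff_D[OF elim(2) y(1)] by simp
    finally have "norm (euler_step h y - y) = h * norm (euler_step h (A y))" using elim by simp
    also have "\<dots> \<le> h * (K * norm (A y))"
      using elim norm_euler_power[OF elim(2), of 1 "A y"] by (intro mult_left_mono) auto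
    finally have 1: "norm (euler_step h y - y) < e / 2" using elim by simp
    have "euler_step h x - x = (euler_step h y - y) - euler_step h (y - x) + (y - x)" by (simp add: V.diff)
    also have "norm \<dots> \<le> norm (euler_step h y - y) + norm (euler_step h (y - x)) + norm (y - x)"
      by (meson norm_triangle_ineq norm_triangle_ineq4 order_trans add_right_mono)
    also have "\<dots> < e / 2 + (K * d + d)"
    proof -
      have "norm (euler_step h (y - x)) \<le> K * norm (y - x)" using norm_euler_power[OF elim(2), of 1] by simp
      also have "\<dots> \<le> K * d" using y(2) K_pos by simp
      finally show ?thesis using 1 y(2) by simp
    qed
    also have "\<dots> = e / 2 + (K + 1) * d" by (simp add: algebra_simps)
    also have "(K + 1) * d = e / 2"
    proof -
      have K1: "K + 1 \<noteq> 0" using K_pos by simp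
      have "e / 2 = d * (K + 1)" by (rule nonzero_divide_eq_eq[THEN iffD1, OF K1 d_def[symmetric]])
      then show ?thesis by (simp only: mult.commute)
    qed
    finally show ?case by (simp add: dist_norm)
  qed
qed

text \<open>
  The local error \<open>T h x - euler_step h x\<close> is propagated by the semigroup and the scheme, both of which
  are bounded by \<open>K\<close>. The power \<open>m\<close> is needed for the induction: an estimate of a single step by
  \<open>K\<close> would lead to powers of \<open>K\<close>.
\<close>
lemma T_euler_telescope:
  assumes h: "h > 0"
  shows "norm ((euler_step h ^^ m) (T (real n * h) x - (euler_step h ^^ n) x)) \<le> real n * (K\<^sup>2 * norm (T h x - euler_step h x))"
proof (induction n arbitrary: m)
  case 0
  then show ?case using linear_0[OF bounded_linear.linear[OF euler_power_linear[OF h]]] by (simp add: T_0)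
next
  case (Suc n)
  interpret V: bounded_linear "euler_step h" using h by (intro bounded_clinear_linear euler_clinear)
  interpret Vm: bounded_linear "euler_step h ^^ m" using h by (rule euler_power_linear)
  let ?t = "real n * h"
  have t: "?t \<ge> 0" using h by simp
  have "T (real (Suc n) * h) x - (euler_step h ^^ Suc n) x
      = T ?t (T h x - euler_step h x) + euler_step h (T ?t x - (euler_step h ^^ n) x)"
    using T_add[OF t, of h x] h t by (simp add: T_diff T_euler V.diff algebra_simps)
  then have "norm ((euler_step h ^^ m) (T (real (Suc n) * h) x - (euler_step h ^^ Suc n) x))
     \<le> norm ((euler_step h ^^ m) (T ?t (T h x - euler_step h x))) + norm ((euler_step h ^^ Suc m) (T ?t x - (euler_step h ^^ n) x))"
    using norm_triangle_ineq by (simp only: Vm.add funpow_Suc_right o_apply)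
  also have "\<dots> \<le> K\<^sup>2 * norm (T h x - euler_step h x) + real n * (K\<^sup>2 * norm (T h x - euler_step h x))"
  proof (intro add_mono Suc.IH)
    have "norm ((euler_step h ^^ m) (T ?t (T h x - euler_step h x))) \<le> K * norm (T ?t (T h x - euler_step h x))"
      by (rule norm_euler_power[OF h])
    also have "\<dots> \<le> K * (K * norm (T h x - euler_step h x))"
      using K_pos by (intro mult_left_mono norm_T t) auto
    finally show "norm ((euler_step h ^^ m) (T ?t (T h x - euler_step h x))) \<le> K\<^sup>2 * norm (T h x - euler_step h x)"
      by (simp add: power2_eq_square mult.assoc)
  qed
  finally show ?case by (simp add: algebra_simps)
qed

text \<open>
  For \<open>x\<close> in the domain of the generator the local error is \<open>o(h)\<close>, and \<open>n\<close> steps of length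
  \<open>t / n\<close> accumulate to an error that tends to \<open>0\<close>.
\<close>
lemma euler_power_tendsto_D:
  assumes x: "x \<in> D" and t: "t > 0"
  shows "(\<lambda>n. (euler_step (t / real n) ^^ n) x) \<longlonglongrightarrow> T t x"
proof -
  have "((\<lambda>h. (T h x - x) /\<^sub>R h - - euler_step h (A x)) \<longlongrightarrow> - A x - - A x) (at_right 0)"
    by (intro tendsto_diff tendsto_minus generator_tendsto x euler_tendsto)
  then have "((\<lambda>h. (T h x - euler_step h x) /\<^sub>R h) \<longlongrightarrow> 0) (at_right 0)"
  proof (simp, elim Lim_transform_eventually, intro eventually_at_rightI[of 0 1])
    fix h :: real assume "h \<in> {0<..<1}"
    then show "(T h x - x) /\<^sub>R h + euler_step h (A x) = (T h x - euler_step h x) /\<^sub>R h"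
      using euler_diff_D[of h x] x by (simp add: algebra_simps)
  qed simp
  moreover have "filterlim (\<lambda>n. t / real n) (at_right 0) sequentially"
    unfolding filterlim_at_right_to_0[symmetric] filterlim_at
    using t by (auto intro!: eventually_sequentiallyI[of 1] tendsto_divide_0[OF tendsto_const] filterlim_at_top_imp_at_infinity filterlim_real_sequentially)
  ultimately have lim: "(\<lambda>n. (T (t / real n) x - euler_step (t / real n) x) /\<^sub>R (t / real n)) \<longlonglongrightarrow> 0"
    by (rule filterlim_compose)
  have "(\<lambda>n. t * K\<^sup>2 * norm ((T (t / real n) x - euler_step (t / real n) x) /\<^sub>R (t / real n))) \<longlonglongrightarrow> 0"
    using tendsto_mult[OF tendsto_const[of "t * K\<^sup>2"] tendsto_norm[OF lim]] by simp
  then have "(\<lambda>n. T t x - (euler_step (t / real n) ^^ n) x) \<longlonglongrightarrow> 0"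
  proof (rule Lim_null_comparison[rotated], intro eventually_sequentiallyI[of 1])
    fix n :: nat assume n: "1 \<le> n"
    then have "t / real n > 0" using t by simp
    from T_euler_telescope[OF this, of 0 n x] n t
    show "norm (T t x - (euler_step (t / real n) ^^ n) x)
        \<le> t * K\<^sup>2 * norm ((T (t / real n) x - euler_step (t / real n) x) /\<^sub>R (t / real n))"
      by (simp add: divide_simps mult_ac)
  qed
  from tendsto_diff[OF tendsto_const[of "T t x"] this] show ?thesis by simp
qed

lemma euler_power_tendsto:
  assumes t: "t > 0"
  shows "(\<lambda>n. (euler_step (t / real n) ^^ n) x) \<longlonglongrightarrow> T t x"
proof (rule tendstoI)
  fix e :: real assume e: "e > 0"
  define d where "d = e / (4 * K)"
  have d: "d > 0" using e K_pos by (simp add: d_def)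
  obtain y where y: "y \<in> D" "norm (y - x) < d" using D_dense[OF d] by blast
  have Kd: "K * norm (y - x) < e / 4"
    using y(2) K_pos by (simp add: d_def field_simps)
  have "\<forall>\<^sub>F n in sequentially. dist ((euler_step (t / real n) ^^ n) y) (T t y) < e / 2"
    using e by (intro tendstoD[OF euler_power_tendsto_D[OF y(1) t]]) simp
  moreover have "\<forall>\<^sub>F n in sequentially. n > 0" by (rule eventually_gt_at_top)
  ultimately show "\<forall>\<^sub>F n in sequentially. dist ((euler_step (t / real n) ^^ n) x) (T t x) < e"
  proof eventually_elim
    case (elim n)
    let ?V = "euler_step (t / real n) ^^ n"
    have h: "t / real n > 0" using elim t by simp
    interpret V: bounded_linear ?V using h by (rule euler_power_linear)
    have "?V x - T t x = (?V y - T t y) - ?V (y - x) + T t (y - x)"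
      using t by (simp add: V.diff T_diff)
    also have "norm \<dots> \<le> norm (?V y - T t y) + norm (?V (y - x)) + norm (T t (y - x))"
      by (meson norm_triangle_ineq norm_triangle_ineq4 order_trans add_right_mono)
    also have "\<dots> < e / 2 + e / 4 + e / 4"
      using elim norm_euler_power[OF h, of n "y - x"] norm_T[of t "y - x"] Kd t
      by (auto simp: dist_norm)
    finally show ?case by (simp add: dist_norm)
  qed
qed

text \<open>
  With \<open>h = t / n\<close> and \<open>V = euler_step h\<close>, the operator \<open>(1 - z V)\<^sup>-\<^sup>1\<close> is
  \<open>1 + (z / h) (w + A)\<^sup>-\<^sup>1\<close> for \<open>w = (1 - z) / h\<close>, and on the circle of radius \<open>n / (n + 1)\<close> the
  point \<open>w\<close> has real part at least \<open>1 / (2 t)\<close>. So \<open>power_bounded_decay\<close> applies, with a bound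
  that becomes \<open>M / t\<close> as \<open>n\<close> tends to infinity.
\<close>
lemma semigroup_decay:
  assumes t: "t > 0" and M: "M \<ge> 0" and B: "bounded_clinear B"
    and comm: "\<And>s x. s \<ge> 0 \<Longrightarrow> T s (B x) = B (T s x)"
    and bd: "\<And>z x. Re z \<ge> 1 / (2 * t) \<Longrightarrow> norm (laplace z (B x)) \<le> M * norm x"
  shows "norm (T t (B x)) \<le> 9 * K\<^sup>2 * M / t * norm x"
proof -
  interpret B: bounded_linear B using B by (rule bounded_clinear_linear)
  obtain b where b: "b \<ge> 0" "\<And>x. norm (B x) \<le> b * norm x"
    using B.nonneg_bounded by (metis mult.commute)
  have step: "norm ((euler_step (t / real n) ^^ n) (B x)) \<le> 9 * K\<^sup>2 * (b / real n + M / t) * norm x" if n: "n > 0" for n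
  proof -
    define h where "h = t / real n"
    have h: "h > 0" using n t by (simp add: h_def)
    let ?V = "euler_step h" and ?w = "complex_of_real (1 / h)"
    \<comment> \<open>The inverse of \<open>1 - z V\<close>.\<close>
    define P where "P z x = x + (z / complex_of_real h) *\<^sub>C laplace ((1 - z) / complex_of_real h) x" for z x
    have Re: "Re ((1 - z) / complex_of_real h) \<ge> 1 / (2 * t)" if z: "cmod z = real n / real (Suc n)" for z
    proof -
      have "1 / 2 / t \<le> real n / real (Suc n) / t"
        using n t by (intro divide_right_mono) (auto simp: field_simps)
      then have "1 / (2 * t) \<le> (1 - real n / real (Suc n)) / h"
        using n t by (simp add: h_def field_simps)
      also have "\<dots> \<le> (1 - Re z) / h"
        using h z complex_Re_le_cmod[of z] by (intro divide_right_mono) auto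
      finally show ?thesis by simp
    qed
    have P: "P z (y - z *\<^sub>C ?V y) = y" if z: "cmod z = real n / real (Suc n)" for z y
    proof -
      let ?u = "(1 - z) / complex_of_real h" and ?k = "z / complex_of_real h"
      have "Re ?u > 0" using Re[OF z] t by (smt (verit) divide_pos_pos)
      then have ru: "is_resolvent D A ?u (laplace ?u)" by (rule is_resolvent_laplace)
      have rw: "is_resolvent D A ?w (laplace ?w)" using h by (intro is_resolvent_laplace) simp
      interpret L: bounded_linear "laplace ?u" using ru by (simp add: is_resolvent_def bounded_clinear_linear)
      have "?w - ?u = ?k" using h by (simp add: field_simps)
      then have id: "laplace ?u y - laplace ?w y = ?k *\<^sub>C laplace ?u (laplace ?w y)"
        using resolvent_identity[OF ru rw, of y] by simp
      have zV: "z *\<^sub>C ?V y = ?k *\<^sub>C laplace ?w y" by (simp add: euler_eq scaleC_scaleC)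
      have "laplace ?u (y - z *\<^sub>C ?V y) = laplace ?u y - ?k *\<^sub>C laplace ?u (laplace ?w y)"
        unfolding zV L.diff using ru by (simp add: is_resolvent_def bounded_clinear_scaleC)
      also have "\<dots> = laplace ?w y" unfolding id[symmetric] by simp
      finally show ?thesis unfolding P_def zV by simp
    qed
    have PB: "norm (P z (B y)) \<le> (b + M / h) * norm y" if z: "cmod z = real n / real (Suc n)" for z y
    proof -
      have "norm (P z (B y)) \<le> norm (B y) + cmod z / h * norm (laplace ((1 - z) / complex_of_real h) (B y))"
        unfolding P_def using h by (intro order_trans[OF norm_triangle_ineq]) (simp add: norm_scaleC norm_divide)
      also have "\<dots> \<le> b * norm y + 1 / h * (M * norm y)"
        using h z n by (intro add_mono b mult_mono divide_right_mono bd Re) auto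
      finally show ?thesis by (simp add: algebra_simps)
    qed
    have BV: "B (?V y) = ?V (B y)" for y
      using h laplace_commute[OF _ B comm] by (simp add: euler_eq bounded_clinear_scaleC[OF B])
    have "norm ((?V ^^ n) (B x)) \<le> 9 * K\<^sup>2 * (b + M / h) / real n * norm x"
      by (rule power_bounded_decay[OF euler_clinear[OF h] B
            BV norm_euler_power[OF h] _ n refl P PB])
        (use h K_pos M b in auto)
    also have "(b + M / h) / real n = b / real n + M / t" using n t by (simp add: h_def field_simps)
    then have "9 * K\<^sup>2 * (b + M / h) / real n * norm x = 9 * K\<^sup>2 * (b / real n + M / t) * norm x"
      by (metis times_divide_eq_right)
    finally show ?thesis by (simp add: h_def)
  qed
  have "norm (T t (B x)) \<le> 9 * K\<^sup>2 * (0 + M / t) * norm x"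
  proof (rule tendsto_le[OF sequentially_bot])
    show "(\<lambda>n. 9 * K\<^sup>2 * (b / real n + M / t) * norm x) \<longlonglongrightarrow> 9 * K\<^sup>2 * (0 + M / t) * norm x"
      by (intro tendsto_intros tendsto_divide_0[OF tendsto_const] filterlim_at_top_imp_at_infinity filterlim_real_sequentially)
    show "(\<lambda>n. norm ((euler_step (t / real n) ^^ n) (B x))) \<longlonglongrightarrow> norm (T t (B x))"
      by (intro tendsto_norm euler_power_tendsto t)
    show "\<forall>\<^sub>F n in sequentially. norm ((euler_step (t / real n) ^^ n) (B x)) \<le> 9 * K\<^sup>2 * (b / real n + M / t) * norm x"
      by (rule eventually_mono[OF eventually_gt_at_top[of 0] step])
  qed
  then show ?thesis by simp
qed

end

section \<open>Regularly varying rates\<close>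

definition growth :: "real \<Rightarrow> real \<Rightarrow> real \<Rightarrow> real"
  where "growth \<alpha> \<beta> s = s powr (- \<alpha>) * ln (1 / s) powr (- \<beta>)"

definition rate :: "real \<Rightarrow> real \<Rightarrow> real \<Rightarrow> real"
  where "rate \<alpha> \<beta> t = t powr (- 1 / \<alpha>) * ln t powr (- \<beta> / \<alpha>)"

text \<open>
  In terms of \<open>y = ln u\<close> the function is \<open>exp (p * y - b * ln y)\<close>, whose exponent has derivative
  \<open>p - b / y\<close>.
\<close>
lemma powr_ln_powr_mono:
  fixes u v p b :: real
  assumes p: "p > 0" and b: "b \<ge> 0" and u: "1 < u" "b / p \<le> ln u" and uv: "u \<le> v"
  shows "u powr p * ln u powr (- b) \<le> v powr p * ln v powr (- b)"
proof -
  have x: "0 < ln u" "ln u \<le> ln v" using u uv by auto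
  have eq: "w powr p * ln w powr (- b) = exp (p * ln w - b * ln (ln w))" if "w > 1" for w
    using that by (simp add: powr_def exp_add[symmetric])
  have "ln (ln v) - ln (ln u) = ln (ln v / ln u)" using x by (simp add: ln_div)
  also have "\<dots> \<le> ln v / ln u - 1" using x by (intro ln_le_minus_one) auto
  also have "\<dots> = (ln v - ln u) / ln u" using x by (simp add: diff_divide_distrib)
  finally have "b * (ln (ln v) - ln (ln u)) \<le> b * ((ln v - ln u) / ln u)"
    using b by (rule mult_left_mono)
  also have "\<dots> = (b / ln u) * (ln v - ln u)" by simp
  also have "\<dots> \<le> p * (ln v - ln u)"
    using x u p by (intro mult_right_mono) (auto simp: field_simps)
  finally have "p * ln u - b * ln (ln u) \<le> p * ln v - b * ln (ln v)" by (simp add: algebra_simps)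
  then show ?thesis using u uv by (simp add: eq)
qed

lemma growth_inverse:
  assumes "0 < s"
  shows "s * growth \<alpha> \<beta> s = (1 / s) powr (\<alpha> - 1) * ln (1 / s) powr (- \<beta>)"
proof -
  have "s * s powr (- \<alpha>) = s powr (1 - \<alpha>)"
    using powr_add[of s 1 "- \<alpha>"] assms by simp
  also have "\<dots> = (1 / s) powr (\<alpha> - 1)"
    using assms by (simp add: powr_divide powr_minus_divide[symmetric])
  finally show ?thesis by (simp add: growth_def mult.assoc[symmetric])
qed

lemma scaled_growth_antimono:
  assumes \<alpha>: "\<alpha> > 1" and \<beta>: "\<beta> \<ge> 0" and s: "0 < r" "r \<le> s" "s < 1" "s \<le> exp (- (\<beta> / (\<alpha> - 1)))"
  shows "s * growth \<alpha> \<beta> s \<le> r * growth \<alpha> \<beta> r"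
proof -
  have "ln s \<le> - (\<beta> / (\<alpha> - 1))" using s ln_mono[of s "exp (- (\<beta> / (\<alpha> - 1)))"] by simp
  then have "\<beta> / (\<alpha> - 1) \<le> ln (1 / s)" using s by (simp add: ln_div)
  then have "(1 / s) powr (\<alpha> - 1) * ln (1 / s) powr (- \<beta>) \<le> (1 / r) powr (\<alpha> - 1) * ln (1 / r) powr (- \<beta>)"
    using s \<alpha> \<beta> by (intro powr_ln_powr_mono) (auto simp: field_simps)
  then show ?thesis using s by (simp add: growth_inverse)
qed

lemma rate_pos: "t > 1 \<Longrightarrow> 0 < rate \<alpha> \<beta> t"
  by (simp add: rate_def)

lemma growth_pos: "0 < s \<Longrightarrow> s < 1 \<Longrightarrow> 0 < growth \<alpha> \<beta> s"
  by (simp add: growth_def)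

lemma rate_le_powr:
  assumes "\<alpha> > 1" "\<beta> \<ge> 0" "t \<ge> exp 1"
  shows "rate \<alpha> \<beta> t \<le> t powr (- 1 / \<alpha>)"
proof -
  have "t > 0" using assms(3) exp_gt_zero[of 1] by linarith
  then have "ln t \<ge> 1" using assms(3) by (simp add: ln_ge_iff)
  then have "ln t powr (- \<beta> / \<alpha>) \<le> ln t powr 0"
    using assms by (intro powr_mono) (auto simp: divide_nonpos_pos)
  then show ?thesis using \<open>ln t \<ge> 1\<close> by (simp add: rate_def mult_left_le)
qed

lemma growth_rate_le:
  assumes \<alpha>: "\<alpha> > 1" and \<beta>: "\<beta> \<ge> 0" and t: "t \<ge> exp 1"
  shows "growth \<alpha> \<beta> (rate \<alpha> \<beta> t) \<le> \<alpha> powr \<beta> * t"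
proof -
  have t0: "t > 1" using t exp_ge_add_one_self[of 1] by linarith
  have lt: "ln t > 0" using t0 by simp
  let ?d = "rate \<alpha> \<beta> t"
  have d: "?d > 0" using t0 by (rule rate_pos)
  have "ln ?d \<le> ln (t powr (- 1 / \<alpha>))" using rate_le_powr[OF \<alpha> \<beta> t] d by (intro ln_mono) auto
  also have "\<dots> = - (ln t / \<alpha>)" using t0 by (simp add: ln_powr)
  finally have "ln t / \<alpha> \<le> ln (1 / ?d)" using d by (simp add: ln_div)
  then have "ln (1 / ?d) powr (- \<beta>) \<le> (ln t / \<alpha>) powr (- \<beta>)"
    using lt \<alpha> \<beta> by (intro powr_mono2') auto
  also have "\<dots> = \<alpha> powr \<beta> * ln t powr (- \<beta>)"
    using lt \<alpha> by (simp add: powr_divide powr_minus divide_simps)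
  finally have "growth \<alpha> \<beta> ?d \<le> ?d powr (- \<alpha>) * (\<alpha> powr \<beta> * ln t powr (- \<beta>))"
    unfolding growth_def by (intro mult_left_mono) auto
  also have "?d powr (- \<alpha>) = t * ln t powr \<beta>"
    using t0 lt \<alpha> unfolding rate_def by (subst powr_mult) (auto simp: powr_powr)
  also have "t * ln t powr \<beta> * (\<alpha> powr \<beta> * ln t powr (- \<beta>)) = \<alpha> powr \<beta> * t"
    using lt by (simp add: powr_minus)
  finally show ?thesis .
qed

lemma rate_tendsto_0:
  assumes "\<alpha> > 1" "\<beta> \<ge> 0"
  shows "(rate \<alpha> \<beta> \<longlongrightarrow> 0) at_top"
proof (rule tendsto_sandwich[OF _ _ tendsto_const])
  show "((\<lambda>t. t powr (- 1 / \<alpha>)) \<longlongrightarrow> 0) at_top"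
    using assms by (intro tendsto_neg_powr filterlim_ident) auto
  show "\<forall>\<^sub>F t in at_top. 0 \<le> rate \<alpha> \<beta> t" by (simp add: rate_def)
  show "\<forall>\<^sub>F t in at_top. rate \<alpha> \<beta> t \<le> t powr (- 1 / \<alpha>)"
    by (rule eventually_mono[OF eventually_ge_at_top rate_le_powr[OF assms]])
qed

text \<open>
  Multiplication by a power slightly larger than \<open>1 / \<alpha>\<close> makes the rate increasing. This replaces
  the exact rate by a pure power when it is integrated.
\<close>
lemma rate_regularly_varying:
  assumes \<alpha>: "\<alpha> > 1" and \<beta>: "\<beta> \<ge> 0" and g: "1 / \<alpha> < \<gamma>"
    and t: "1 < \<tau>" "\<beta> / \<alpha> / (\<gamma> - 1 / \<alpha>) \<le> ln \<tau>" "\<tau> \<le> t"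
  shows "\<tau> powr \<gamma> * rate \<alpha> \<beta> \<tau> \<le> t powr \<gamma> * rate \<alpha> \<beta> t"
proof -
  have eq: "w powr \<gamma> * rate \<alpha> \<beta> w = w powr (\<gamma> - 1 / \<alpha>) * ln w powr (- (\<beta> / \<alpha>))" for w
    by (simp add: rate_def mult.assoc[symmetric] powr_add[symmetric])
  show ?thesis unfolding eq using assms by (intro powr_ln_powr_mono) auto
qed

lemma rate_times_bounded_below:
  assumes \<alpha>: "\<alpha> > 1" and \<beta>: "\<beta> \<ge> 0"
  shows "\<exists>c>0. \<exists>t0. \<forall>t\<ge>t0. c \<le> t * rate \<alpha> \<beta> t"
proof -
  define \<tau> where "\<tau> = exp (\<beta> / \<alpha> / (1 - 1 / \<alpha>) + 1)"
  have q: "1 / \<alpha> < 1" using \<alpha> by simp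
  then have "0 \<le> \<beta> / \<alpha> / (1 - 1 / \<alpha>)" using \<alpha> \<beta> by (intro divide_nonneg_nonneg) auto
  then have \<tau>: "1 < \<tau>" "\<beta> / \<alpha> / (1 - 1 / \<alpha>) \<le> ln \<tau>" by (auto simp: \<tau>_def)
  have "0 < \<tau> * rate \<alpha> \<beta> \<tau>" using \<tau> rate_pos by simp
  moreover have "\<tau> * rate \<alpha> \<beta> \<tau> \<le> t * rate \<alpha> \<beta> t" if "\<tau> \<le> t" for t
    using rate_regularly_varying[OF \<alpha> \<beta> q \<tau> that] \<tau> that by simp
  ultimately show ?thesis by blast
qed

lemma growth_dominates_inverse:
  assumes \<alpha>: "\<alpha> > 1" and \<beta>: "\<beta> \<ge> 0"
  shows "\<exists>c>0. \<exists>s0>0. s0 < 1 \<and> (\<forall>s. 0 < s \<longrightarrow> s < s0 \<longrightarrow> 1 / s \<le> c * growth \<alpha> \<beta> s)"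
proof -
  define s0 where "s0 = exp (- (\<beta> / (\<alpha> - 1)) - 1)"
  have "0 \<le> \<beta> / (\<alpha> - 1)" using \<alpha> \<beta> by simp
  then have s0: "0 < s0" "s0 < 1" "s0 \<le> exp (- (\<beta> / (\<alpha> - 1)))" by (auto simp: s0_def)
  define c where "c = s0 * growth \<alpha> \<beta> s0"
  have c: "c > 0" using s0 growth_pos by (simp add: c_def)
  have "1 / s \<le> 1 / c * growth \<alpha> \<beta> s" if s: "0 < s" "s < s0" for s
  proof -
    have "c \<le> s * growth \<alpha> \<beta> s" unfolding c_def
      using s s0 by (intro scaled_growth_antimono[OF \<alpha> \<beta>]) auto
    then show ?thesis using s c by (simp add: field_simps)
  qed
  moreover have "1 / c > 0" using c by simp
  ultimately show ?thesis using s0 by blast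
qed

text \<open>
  The times \<open>k * growth \<alpha> \<beta> s\<close> are those at which the semigroup is evaluated to estimate the
  resolvent at \<open>s\<close>. The bound \<open>1 / s\<close> from below shows that they tend to infinity, and it lets
  \<open>ln (1 / s)\<close> replace the logarithm of the time.
\<close>
lemma rate_of_scaled_growth_le:
  assumes \<alpha>: "\<alpha> > 1" and \<beta>: "\<beta> \<ge> 0" and \<eta>: "\<eta> > 0"
  shows "\<exists>k>0. \<exists>s0>0. s0 < 1 \<and> (\<forall>s. 0 < s \<longrightarrow> s < s0 \<longrightarrow>
    1 / s \<le> k * growth \<alpha> \<beta> s \<and> rate \<alpha> \<beta> (k * growth \<alpha> \<beta> s) \<le> \<eta> * s)"
proof -
  obtain c s0 where c: "c > 0" and s0: "s0 > 0" "s0 < 1"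
    and dom: "\<And>s. 0 < s \<Longrightarrow> s < s0 \<Longrightarrow> 1 / s \<le> c * growth \<alpha> \<beta> s"
    using growth_dominates_inverse[OF \<alpha> \<beta>] by blast
  define k where "k = max c (\<eta> powr (- \<alpha>))"
  have k: "k > 0" "c \<le> k" "\<eta> powr (- \<alpha>) \<le> k" using c by (auto simp: k_def)
  have kr: "k powr (- 1 / \<alpha>) \<le> \<eta>"
  proof -
    have "k powr (- 1 / \<alpha>) \<le> (\<eta> powr (- \<alpha>)) powr (- 1 / \<alpha>)"
      using k \<eta> \<alpha> by (intro powr_mono2') auto
    also have "\<dots> = \<eta>" using \<eta> \<alpha> by (simp add: powr_powr)
    finally show ?thesis .
  qed
  have "1 / s \<le> k * growth \<alpha> \<beta> s \<and> rate \<alpha> \<beta> (k * growth \<alpha> \<beta> s) \<le> \<eta> * s" if s: "0 < s" "s < s0" for s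
  proof
    have g: "growth \<alpha> \<beta> s > 0" using s s0 by (intro growth_pos) auto
    have "c * growth \<alpha> \<beta> s \<le> k * growth \<alpha> \<beta> s" using k g by (intro mult_right_mono) auto
    then show *: "1 / s \<le> k * growth \<alpha> \<beta> s" using dom[OF s] by linarith
    let ?t = "k * growth \<alpha> \<beta> s" and ?L = "ln (1 / s)"
    have L: "?L > 0" "?L \<le> ln ?t" using s s0 * k g by (auto intro!: ln_mono)
    have "rate \<alpha> \<beta> ?t \<le> ?t powr (- 1 / \<alpha>) * ?L powr (- \<beta> / \<alpha>)"
      unfolding rate_def using L \<alpha> \<beta> by (intro mult_left_mono powr_mono2') auto
    also have "?t powr (- 1 / \<alpha>) = k powr (- 1 / \<alpha>) * (s * ?L powr (\<beta> / \<alpha>))"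
      using k s L \<alpha> unfolding growth_def by (simp add: powr_mult powr_powr)
    also have "k powr (- 1 / \<alpha>) * (s * ?L powr (\<beta> / \<alpha>)) * ?L powr (- \<beta> / \<alpha>) = k powr (- 1 / \<alpha>) * s"
      using L by (simp add: powr_minus)
    also have "\<dots> \<le> \<eta> * s" using kr s by (intro mult_right_mono) auto
    finally show "rate \<alpha> \<beta> ?t \<le> \<eta> * s" .
  qed
  then show ?thesis using k s0 by blast
qed

section \<open>From resolvent growth to decay\<close>

lemma onorm_le_twice:
  fixes f :: "'a::real_normed_vector \<Rightarrow> 'b::real_normed_vector"
  assumes b: "bounded_linear f" and r: "\<And>x. norm (f x) \<le> r * norm x + c * onorm f * norm x" and c: "c \<le> 1 / 2" and r0: "r \<ge> 0"
  shows "onorm f \<le> 2 * r"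
proof -
  have o: "0 \<le> onorm f" using b by (rule onorm_pos_le)
  have "onorm f \<le> r + 1 / 2 * onorm f"
  proof (rule onorm_bound)
    fix x :: 'a
    have "c * (onorm f * norm x) \<le> 1 / 2 * (onorm f * norm x)"
      using c o by (intro mult_right_mono) auto
    then show "norm (f x) \<le> (r + 1 / 2 * onorm f) * norm x" using r[of x] by (simp add: algebra_simps)
  qed (use r0 o in auto)
  then show ?thesis by simp
qed

text \<open>
  By the resolvent identity, the norm at most doubles on a neighbourhood of each point, the size of
  which depends on the norm at that point only. Compactness does the rest.
\<close>
lemma resolvent_locally_bounded:
  fixes Q :: "real \<Rightarrow> 'a::complex_inner \<Rightarrow> 'a"
  assumes res: "\<And>s. s \<in> S \<Longrightarrow> is_resolvent D A (\<i> * complex_of_real s) (Q s)" and S: "compact S"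
  shows "\<exists>C. \<forall>s\<in>S. onorm (Q s) \<le> C"
proof -
  define r where "r s = onorm (Q s) + 1" for s
  have Ql: "bounded_linear (Q s)" if "s \<in> S" for s
    using res[OF that] by (simp add: is_resolvent_def bounded_clinear_linear)
  have r: "r s > 0" if "s \<in> S" for s
    using onorm_pos_le[OF Ql[OF that]] by (simp add: r_def)
  have loc: "onorm (Q s) \<le> 2 * r s0" if s: "s \<in> S" and s0: "s0 \<in> S" and d: "s \<in> ball s0 (1 / (2 * r s0))" for s s0
  proof (rule onorm_le_twice[where c = "\<bar>s - s0\<bar> * r s0"])
    show "bounded_linear (Q s)" using s by (rule Ql)
    fix x
    have 0: "norm (Q s0 x) \<le> r s0 * norm x"
      using onorm[OF Ql[OF s0], of x] mult_right_mono[of "onorm (Q s0)" "r s0" "norm x"] by (simp add: r_def)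
    have "Q s x = Q s0 x + (\<i> * complex_of_real (s0 - s)) *\<^sub>C Q s (Q s0 x)"
      using resolvent_identity[OF res[OF s] res[OF s0], of x] by (simp add: algebra_simps)
    then have "norm (Q s x) \<le> norm (Q s0 x) + cmod (\<i> * complex_of_real (s0 - s)) * norm (Q s (Q s0 x))"
      by (metis norm_triangle_ineq norm_scaleC)
    also have "cmod (\<i> * complex_of_real (s0 - s)) = \<bar>s - s0\<bar>" by (simp add: norm_mult del: of_real_diff)
    also have "\<bar>s - s0\<bar> * norm (Q s (Q s0 x)) \<le> \<bar>s - s0\<bar> * (onorm (Q s) * (r s0 * norm x))"
      using onorm[OF Ql[OF s]] 0 onorm_pos_le[OF Ql[OF s]]
      by (intro mult_left_mono) (meson mult_left_mono order_trans, simp)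
    finally show "norm (Q s x) \<le> r s0 * norm x + \<bar>s - s0\<bar> * r s0 * onorm (Q s) * norm x"
      using 0 by (simp add: mult_ac)
  next
    show "\<bar>s - s0\<bar> * r s0 \<le> 1 / 2"
      using d r[OF s0] by (simp add: dist_real_def field_simps abs_minus_commute)
    show "0 \<le> r s0" using r[OF s0] by simp
  qed
  obtain F where F: "F \<subseteq> S" "finite F" "S \<subseteq> (\<Union>s\<in>F. ball s (1 / (2 * r s)))"
  proof (rule compactE_image[OF S, of S "\<lambda>s. ball s (1 / (2 * r s))"])
    show "S \<subseteq> (\<Union>s\<in>S. ball s (1 / (2 * r s)))" using r by force
  qed auto
  show ?thesis
  proof (intro exI ballI)
    fix s assume s: "s \<in> S"
    then obtain s0 where s0: "s0 \<in> F" "s \<in> ball s0 (1 / (2 * r s0))" using F by blast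
    have "onorm (Q s) \<le> 2 * r s0" using s s0 F by (intro loc) auto
    also have "\<dots> \<le> (\<Sum>s\<in>F. 2 * r s)"
      using s0 F r by (intro member_le_sum) (auto simp: less_imp_le subset_iff)
    finally show "onorm (Q s) \<le> (\<Sum>s\<in>F. 2 * r s)" .
  qed
qed

context bounded_C0_semigroup
begin

text \<open>
  The operator \<open>A (1 + A)\<^sup>-\<^sup>1\<close>, in a form that shows it to be bounded.
\<close>
definition gen_res :: "'a \<Rightarrow> 'a" where "gen_res x = x - laplace 1 x"

lemma gen_res_clinear: "bounded_clinear gen_res"
proof -
  have L: "bounded_clinear (laplace 1)" by (rule laplace_clinear) simp
  from bounded_linear_sub[OF bounded_linear_ident bounded_clinear_linear[OF L]]
  show ?thesis
    by (simp add: bounded_clinear_def gen_res_def[abs_def] bounded_clinear_scaleC[OF L] scaleC_right_simps)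
qed

lemma T_gen_res: "s \<ge> 0 \<Longrightarrow> T s (gen_res x) = gen_res (T s x)"
  by (simp add: gen_res_def T_diff T_laplace)

lemma norm_laplace_1: "norm (laplace 1 x) \<le> K * norm x"
  using norm_laplace[of 1 x] by simp

lemma norm_gen_res: "norm (gen_res x) \<le> (1 + K) * norm x"
  using norm_triangle_ineq4[of x "laplace 1 x"] norm_laplace_1[of x] by (simp add: gen_res_def algebra_simps)

text \<open>
  The first form serves to bound \<open>R(z) A (1 + A)\<^sup>-\<^sup>1\<close> for \<open>z\<close> near \<open>0\<close>, where \<open>z R(z)\<close> is
  smaller than \<open>R(z)\<close>; the second one recovers \<open>R(z)\<close> from it.
\<close>
lemma laplace_gen_res:
  assumes z: "Re z > 0"
  shows "laplace z (gen_res x) = laplace 1 x - z *\<^sub>C laplace z (laplace 1 x)"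
    and "(1 - z) *\<^sub>C laplace z (gen_res x) = laplace 1 x - z *\<^sub>C laplace z x"
proof -
  note rz = is_resolvent_laplace[OF z]
  interpret L: bounded_linear "laplace z" using rz by (simp add: is_resolvent_def bounded_clinear_linear)
  have r1: "is_resolvent D A 1 (laplace 1)" by (rule is_resolvent_laplace) simp
  have id: "laplace z x - laplace 1 x = (1 - z) *\<^sub>C laplace z (laplace 1 x)" by (rule resolvent_identity[OF rz r1])
  have eq: "laplace z (gen_res x) = laplace z x - laplace z (laplace 1 x)" by (simp add: gen_res_def L.diff)
  from id have "laplace z x = laplace 1 x + (1 - z) *\<^sub>C laplace z (laplace 1 x)" by (simp add: algebra_simps)
  then show "laplace z (gen_res x) = laplace 1 x - z *\<^sub>C laplace z (laplace 1 x)"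
    unfolding eq by (simp add: scaleC_diff_left)
  show "(1 - z) *\<^sub>C laplace z (gen_res x) = laplace 1 x - z *\<^sub>C laplace z x"
    unfolding eq scaleC_right_simps id[symmetric] by (simp add: scaleC_diff_left)
qed

text \<open>
  The distance \<open>Re z\<close> to the axis is compensated by the factor \<open>1 / Re z\<close> in the bound for the
  resolvent at \<open>z\<close>.
\<close>
lemma laplace_le_resolvent_on_axis:
  assumes z: "Re z > 0" and res: "is_resolvent D A (\<i> * complex_of_real (Im z)) Q"
  shows "norm (laplace z x) \<le> (1 + K) * onorm Q * norm x"
proof -
  interpret Q: bounded_linear Q using res by (simp add: is_resolvent_def bounded_clinear_linear)
  have "z - \<i> * complex_of_real (Im z) = complex_of_real (Re z)" by (simp add: complex_eq_iff)
  then have "Q x - laplace z x = complex_of_real (Re z) *\<^sub>C Q (laplace z x)"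
    using resolvent_identity[OF res is_resolvent_laplace[OF z], of x] by simp
  then have "laplace z x = Q (x - Re z *\<^sub>R laplace z x)"
    by (simp add: Q.diff Q.scaleR) (simp add: scaleR_scaleC algebra_simps)
  then have "norm (laplace z x) \<le> onorm Q * norm (x - Re z *\<^sub>R laplace z x)"
    using onorm[OF Q.bounded_linear_axioms] by metis
  also have "\<dots> \<le> onorm Q * (norm x + K * norm x)"
  proof (rule mult_left_mono[OF _ onorm_pos_le[OF Q.bounded_linear_axioms]])
    have "norm (Re z *\<^sub>R laplace z x) \<le> K * norm x"
      using norm_laplace[OF z, of x] z by (simp add: field_simps)
    then show "norm (x - Re z *\<^sub>R laplace z x) \<le> norm x + K * norm x"
      using norm_triangle_ineq4[of x "Re z *\<^sub>R laplace z x"] by linarith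
  qed
  finally show ?thesis by (simp add: algebra_simps)
qed

text \<open>
  By \<open>semigroup_decay\<close> it is enough to bound \<open>norm (R(z) A (1 + A)\<^sup>-\<^sup>1)\<close> by a multiple of
  \<open>t * rate \<alpha> \<beta> t\<close> in the half-plane \<open>Re z \<ge> 1 / (2 * t)\<close>. Away from the real line \<open>R(z)\<close>
  itself is bounded. Near it, \<open>\<bar>Im z\<bar>\<close> times the norm of \<open>R(z)\<close> has to be estimated, and the two
  available bounds are used below and above \<open>\<bar>Im z\<bar> = rate \<alpha> \<beta> t\<close>, where they are of the same
  order.
\<close>
lemma decay_of_resolvent_growth:
  assumes res: "\<And>s. s \<noteq> 0 \<Longrightarrow> is_resolvent D A (\<i> * complex_of_real s) (Q s)"
    and \<alpha>: "\<alpha> > 1" and \<beta>: "\<beta> \<ge> 0"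
    and near: "s1 > 0" "\<And>s. s \<noteq> 0 \<Longrightarrow> \<bar>s\<bar> < s1 \<Longrightarrow> onorm (Q s) \<le> C * growth \<alpha> \<beta> \<bar>s\<bar>"
    and far: "\<And>s. \<bar>s\<bar> \<ge> S \<Longrightarrow> onorm (Q s) \<le> C"
  shows "\<exists>C t0. \<forall>t\<ge>t0. \<forall>x. norm (T t (gen_res x)) \<le> C * rate \<alpha> \<beta> t * norm x"
proof -
  \<comment> \<open>Below \<open>exp (- (\<beta> / (\<alpha> - 1)))\<close> the function \<open>s * growth \<alpha> \<beta> s\<close> is decreasing; the further factor
    \<open>exp (- 1)\<close> keeps \<open>s2\<close> below \<open>1\<close> when \<open>\<beta> = 0\<close>.\<close>
  define s2 where "s2 = min s1 (exp (- (\<beta> / (\<alpha> - 1)) - 1))"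
  have "0 \<le> \<beta> / (\<alpha> - 1)" using \<alpha> \<beta> by simp
  then have s2: "0 < s2" "s2 \<le> s1" "s2 < 1" "s2 \<le> exp (- (\<beta> / (\<alpha> - 1)))"
    using near by (auto simp: s2_def min_less_iff_disj min_le_iff_disj)
  have "compact ({- \<bar>S\<bar>..- s2} \<union> {s2..\<bar>S\<bar>})" by (intro compact_Un compact_Icc)
  then obtain C2 where "\<forall>s\<in>{- \<bar>S\<bar>..- s2} \<union> {s2..\<bar>S\<bar>}. onorm (Q s) \<le> C2"
    using resolvent_locally_bounded[of "{- \<bar>S\<bar>..- s2} \<union> {s2..\<bar>S\<bar>}" D A Q] res s2 by fastforce
  then have C2: "onorm (Q s) \<le> C2" if "s2 \<le> \<bar>s\<bar>" "\<bar>s\<bar> \<le> \<bar>S\<bar>" for s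
    using that by (cases "s \<ge> 0") auto
  define C3 where "C3 = max 1 (max C C2)"
  have C3: "C3 \<ge> 1" "C \<le> C3" "C2 \<le> C3" by (auto simp: C3_def)
  have away: "onorm (Q s) \<le> C3" if "s2 \<le> \<bar>s\<bar>" for s
    using C2[of s] far[of s] that C3 by (cases "\<bar>s\<bar> \<le> \<bar>S\<bar>") fastforce+
  obtain c t1 where c: "c > 0" and t1: "\<And>t. t \<ge> t1 \<Longrightarrow> c \<le> t * rate \<alpha> \<beta> t"
    using rate_times_bounded_below[OF \<alpha> \<beta>] by blast
  obtain t2 where t2: "\<And>t. t \<ge> t2 \<Longrightarrow> rate \<alpha> \<beta> t < s2"
    using order_tendstoD(2)[OF rate_tendsto_0[OF \<alpha> \<beta>] s2(1)] by (auto simp: eventually_at_top_linorder)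
  define E where "E = max ((1 + K)\<^sup>2 * C3 / c) (K * ((1 + K) / c + max (2 * K) ((1 + K) * C3 * \<alpha> powr \<beta>)))"
  have E0: "E \<ge> 0" using C3 c K_pos by (auto simp: E_def le_max_iff_disj)
  have main: "norm (laplace z (gen_res x)) \<le> E * (t * rate \<alpha> \<beta> t) * norm x"
    if t: "t \<ge> exp 1" "t \<ge> t1" "t \<ge> t2" and z: "Re z \<ge> 1 / (2 * t)" for t z x
  proof -
    let ?d = "rate \<alpha> \<beta> t" and ?s = "\<bar>Im z\<bar>"
    have t0: "t > 1" using t exp_ge_add_one_self[of 1] by linarith
    have d: "?d > 0" "?d < s2" using t0 t2 t by (auto intro: rate_pos)
    have Rez: "Re z > 0" using z t0 by (smt (verit) divide_pos_pos)
    have ctd: "1 \<le> t * ?d / c" using t1[OF t(2)] c by simp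
    show ?thesis
    proof (cases "s2 \<le> ?s")
      case True
      have "norm (laplace z (gen_res x)) \<le> (1 + K) * onorm (Q (Im z)) * norm (gen_res x)"
        using True s2 by (intro laplace_le_resolvent_on_axis Rez res) auto
      also have "\<dots> \<le> (1 + K) * C3 * ((1 + K) * norm x)"
      proof -
        have "(1 + K) * onorm (Q (Im z)) \<le> (1 + K) * C3"
          using away[OF True] K_pos by (intro mult_left_mono) auto
        from mult_mono[OF this norm_gen_res] show ?thesis using K_pos C3 by simp
      qed
      also have "\<dots> = (1 + K)\<^sup>2 * C3 * norm x * 1" by (simp add: power2_eq_square)
      also have "\<dots> \<le> (1 + K)\<^sup>2 * C3 * norm x * (t * ?d / c)"
        using ctd C3 by (intro mult_left_mono) auto
      also have "\<dots> = (1 + K)\<^sup>2 * C3 / c * (t * ?d) * norm x" by simp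
      also have "\<dots> \<le> E * (t * ?d) * norm x"
        using t0 d by (intro mult_right_mono) (auto simp: E_def)
      finally show ?thesis .
    next
      case False
      let ?F = "max (2 * K) ((1 + K) * C3 * \<alpha> powr \<beta>)"
      have low: "?s * norm (laplace z y) \<le> ?F * (t * ?d) * norm y" for y
      proof (cases "?s \<le> ?d")
        case True
        have "norm (laplace z y) \<le> K / Re z * norm y" by (rule norm_laplace[OF Rez])
        also have "\<dots> \<le> 2 * K * t * norm y"
          using z t0 Rez K_pos by (intro mult_right_mono) (auto simp: field_simps)
        finally have "?s * norm (laplace z y) \<le> ?d * (2 * K * t * norm y)"
          using True d by (intro mult_mono) auto
        also have "\<dots> = 2 * K * (t * ?d * norm y)" by simp
        also have "\<dots> \<le> ?F * (t * ?d * norm y)" using t0 d by (intro mult_right_mono) auto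
        finally show ?thesis by (simp add: mult.assoc)
      next
        case sd: False
        then have s: "?s > 0" "Im z \<noteq> 0" using d by auto
        have "onorm (Q (Im z)) \<le> C * growth \<alpha> \<beta> ?s" using False s2 s by (intro near) auto
        also have "\<dots> \<le> C3 * growth \<alpha> \<beta> ?s" using C3 by (intro mult_right_mono) (auto simp: growth_def)
        finally have q: "onorm (Q (Im z)) \<le> C3 * growth \<alpha> \<beta> ?s" .
        have "?s * growth \<alpha> \<beta> ?s \<le> ?d * growth \<alpha> \<beta> ?d"
          using d sd False s2 by (intro scaled_growth_antimono[OF \<alpha> \<beta>]) auto
        also have "\<dots> \<le> ?d * (\<alpha> powr \<beta> * t)"
          using growth_rate_le[OF \<alpha> \<beta> t(1)] d by (intro mult_left_mono) auto
        finally have sg: "?s * growth \<alpha> \<beta> ?s \<le> \<alpha> powr \<beta> * (t * ?d)" by (simp add: mult_ac)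
        have "?s * norm (laplace z y) \<le> ?s * ((1 + K) * onorm (Q (Im z)) * norm y)"
          using s by (intro mult_left_mono laplace_le_resolvent_on_axis Rez res) auto
        also have "\<dots> \<le> ?s * ((1 + K) * (C3 * growth \<alpha> \<beta> ?s) * norm y)"
          using q K_pos by (intro mult_left_mono mult_right_mono) auto
        also have "\<dots> = (1 + K) * C3 * norm y * (?s * growth \<alpha> \<beta> ?s)" by simp
        also have "\<dots> \<le> (1 + K) * C3 * norm y * (\<alpha> powr \<beta> * (t * ?d))"
          using sg K_pos C3 by (intro mult_left_mono) auto
        also have "\<dots> = (1 + K) * C3 * \<alpha> powr \<beta> * (t * ?d * norm y)" by simp
        also have "\<dots> \<le> ?F * (t * ?d * norm y)" using t0 d by (intro mult_right_mono) auto
        finally show ?thesis by (simp add: mult.assoc)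
      qed
      let ?y = "laplace 1 x"
      have "norm (laplace z (gen_res x)) \<le> norm ?y + cmod z * norm (laplace z ?y)"
        unfolding laplace_gen_res(1)[OF Rez] norm_scaleC[symmetric] by (rule norm_triangle_ineq4)
      also have "cmod z * norm (laplace z ?y) \<le> (Re z + ?s) * norm (laplace z ?y)"
        using cmod_le[of z] Rez by (intro mult_right_mono) auto
      also have "\<dots> = Re z * norm (laplace z ?y) + ?s * norm (laplace z ?y)" by (simp add: algebra_simps)
      also have "\<dots> \<le> K * norm ?y + ?F * (t * ?d) * norm ?y"
        using norm_laplace[OF Rez, of ?y] Rez by (intro add_mono low) (simp add: field_simps)
      also have "norm ?y + (K * norm ?y + ?F * (t * ?d) * norm ?y) = (1 + K) * norm ?y * 1 + ?F * (t * ?d) * norm ?y"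
        by (simp add: algebra_simps)
      also have "\<dots> \<le> (1 + K) * norm ?y * (t * ?d / c) + ?F * (t * ?d) * norm ?y"
        using ctd K_pos by (intro add_right_mono mult_left_mono) auto
      also have "\<dots> = ((1 + K) / c + ?F) * (t * ?d) * norm ?y" by (simp add: algebra_simps add_divide_distrib)
      also have "\<dots> \<le> ((1 + K) / c + ?F) * (t * ?d) * (K * norm x)"
        using norm_laplace_1 K_pos c t0 d by (intro mult_left_mono mult_nonneg_nonneg add_nonneg_nonneg) (auto simp: le_max_iff_disj)
      also have "\<dots> = K * ((1 + K) / c + ?F) * (t * ?d) * norm x" by simp
      also have "\<dots> \<le> E * (t * ?d) * norm x"
        using t0 d by (intro mult_right_mono) (auto simp: E_def)
      finally show ?thesis by simp
    qed
  qed
  show ?thesis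
  proof (intro exI allI impI)
    fix t x assume "t \<ge> max (exp 1) (max t1 t2)"
    then have t: "t \<ge> exp 1" "t \<ge> t1" "t \<ge> t2" by auto
    have t0: "t > 0" using t(1) exp_gt_zero[of 1] by linarith
    have "norm (T t (gen_res x)) \<le> 9 * K\<^sup>2 * (E * (t * rate \<alpha> \<beta> t)) / t * norm x"
      using E0 t0 by (intro semigroup_decay[OF t0 _ gen_res_clinear T_gen_res main[OF t]]) (auto simp: rate_def)
    then show "norm (T t (gen_res x)) \<le> 9 * K\<^sup>2 * E * rate \<alpha> \<beta> t * norm x"
      using t0 by simp
  qed
qed

section \<open>From decay to resolvent growth\<close>

lemma laplace_truncation:
  assumes z: "Re z > 0" and t: "t \<ge> 0"
  shows "laplace z y = integral {0..t} (orbit z y) + exp (- z * complex_of_real t) *\<^sub>C laplace z (T t y)"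
  using T_laplace_shift[OF t z, of y] T_laplace[OF t z, of y]
  by (simp add: scaleC_scaleC exp_add[symmetric])

text \<open>
  The truncated integral grows like \<open>t * rate \<alpha> \<beta> t\<close>, and not faster, because \<open>1 / \<alpha> < 1\<close>:
  for large \<open>s \<le> t\<close>, \<open>rate \<alpha> \<beta> s\<close> is at most \<open>(t / s) powr \<gamma> * rate \<alpha> \<beta> t\<close> with \<open>\<gamma> < 1\<close>, which is
  integrable at \<open>0\<close>.
\<close>
lemma norm_orbit_integral_gen_res:
  assumes \<alpha>: "\<alpha> > 1" and \<beta>: "\<beta> \<ge> 0" and c: "c \<ge> 0"
    and decay: "\<And>t x. t \<ge> t0 \<Longrightarrow> norm (T t (gen_res x)) \<le> c * rate \<alpha> \<beta> t * norm x"
  shows "\<exists>C\<ge>0. \<exists>t1>1. \<forall>t\<ge>t1. \<forall>z x. Re z > 0 \<longrightarrow>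
    norm (integral {0..t} (orbit z (gen_res x))) \<le> (C + C * (t * rate \<alpha> \<beta> t)) * norm x"
proof -
  \<comment> \<open>The exponent \<open>\<gamma> = 1 - p\<close> is the midpoint between \<open>1 / \<alpha>\<close> and \<open>1\<close>.\<close>
  define p where "p = (1 - 1 / \<alpha>) / 2"
  define \<gamma> where "\<gamma> = 1 - p"
  have p: "p > 0" "p < 1" using \<alpha> by (auto simp: p_def field_simps)
  have g: "\<gamma> - 1 / \<alpha> = p" by (simp add: \<gamma>_def p_def field_simps)
  define t1 where "t1 = max t0 (exp (\<beta> / \<alpha> / p + 1))"
  have "0 \<le> \<beta> / \<alpha> / p" using \<alpha> \<beta> p by simp
  then have "1 < exp (\<beta> / \<alpha> / p + 1)" by simp
  then have t1: "t1 \<ge> t0" "t1 > 1" "\<beta> / \<alpha> / p \<le> ln t1"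
    by (auto simp: t1_def ln_ge_iff less_max_iff_disj le_max_iff_disj)
  define C where "C = max (K * (1 + K) * t1) (c / p)"
  have C: "0 \<le> C" "K * (1 + K) * t1 \<le> C" "c / p \<le> C" using c p by (auto simp: C_def le_max_iff_disj)
  have "norm (integral {0..t} (orbit z (gen_res x))) \<le> (C + C * (t * rate \<alpha> \<beta> t)) * norm x"
    if t: "t \<ge> t1" and z: "Re z > 0" for t z x
  proof -
    let ?f = "orbit z (gen_res x)"
    have r: "rate \<alpha> \<beta> t > 0" using t t1 by (intro rate_pos) auto
    have orb: "norm (?f s) \<le> norm (T s (gen_res x))" if "s \<ge> 0" for s
      using that z by (simp add: norm_orbit mult_left_le_one_le)
    have "integral {0..t} ?f = integral {0..t1} ?f + integral {t1..t} ?f"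
      using t t1 by (intro Henstock_Kurzweil_Integration.integral_combine[symmetric] orbit_integrable) auto
    then have "norm (integral {0..t} ?f) \<le> norm (integral {0..t1} ?f) + norm (integral {t1..t} ?f)"
      by (simp add: norm_triangle_ineq)
    also have "norm (integral {0..t1} ?f) \<le> (K * ((1 + K) * norm x)) * (t1 - 0)"
    proof (rule integral_bound)
      show "continuous_on {0..t1} ?f" by (rule continuous_on_subset[OF orbit_continuous]) auto
      fix s assume "s \<in> {0..t1}"
      then have s: "s \<ge> 0" by simp
      have "norm (?f s) \<le> K * norm (gen_res x)" using orb[OF s] norm_T[OF s, of "gen_res x"] by linarith
      also have "\<dots> \<le> K * ((1 + K) * norm x)" using K_pos by (intro mult_left_mono norm_gen_res) auto
      finally show "norm (?f s) \<le> K * ((1 + K) * norm x)" .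
    qed (use t1 in auto)
    also have "(K * ((1 + K) * norm x)) * (t1 - 0) = K * (1 + K) * t1 * norm x" by simp
    also have "\<dots> \<le> C * norm x" using C by (intro mult_right_mono) auto
    also have "norm (integral {t1..t} ?f) \<le> c / p * (t * rate \<alpha> \<beta> t) * norm x"
    proof -
      let ?k = "c * norm x * (t powr \<gamma> * rate \<alpha> \<beta> t)"
      have hi: "((\<lambda>s. ?k * s powr (- \<gamma>)) has_integral ?k * (t powr p / p) - ?k * (t1 powr p / p)) {t1..t}"
      proof (rule fundamental_theorem_of_calculus[OF t])
        fix s assume "s \<in> {t1..t}"
        then have "s > 0" using t1 by simp
        then show "((\<lambda>s. ?k * (s powr p / p)) has_vector_derivative ?k * s powr (- \<gamma>)) (at s within {t1..t})"
          unfolding has_real_derivative_iff_has_vector_derivative[symmetric]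
          using p by (auto intro!: derivative_eq_intros simp: \<gamma>_def)
      qed
      have "norm (integral {t1..t} ?f) \<le> integral {t1..t} (\<lambda>s. ?k * s powr (- \<gamma>))"
      proof (rule Henstock_Kurzweil_Integration.integral_norm_bound_integral)
        show "?f integrable_on {t1..t}" using t1 by (intro orbit_integrable) auto
        show "(\<lambda>s. ?k * s powr (- \<gamma>)) integrable_on {t1..t}" using hi by blast
        fix s assume s: "s \<in> {t1..t}"
        have "s powr \<gamma> * rate \<alpha> \<beta> s \<le> t powr \<gamma> * rate \<alpha> \<beta> t"
          using s t1 g p by (intro rate_regularly_varying[OF \<alpha> \<beta>]) (auto intro: order_trans)
        then have "rate \<alpha> \<beta> s \<le> t powr \<gamma> * rate \<alpha> \<beta> t * s powr (- \<gamma>)"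
          using s t1 by (simp add: powr_minus field_simps)
        then have "c * rate \<alpha> \<beta> s * norm x \<le> c * (t powr \<gamma> * rate \<alpha> \<beta> t * s powr (- \<gamma>)) * norm x"
          using c by (intro mult_right_mono mult_left_mono) auto
        moreover have "norm (?f s) \<le> c * rate \<alpha> \<beta> s * norm x"
          using orb[of s] decay[of s x] s t1 by simp
        ultimately show "norm (?f s) \<le> ?k * s powr (- \<gamma>)" by (simp add: mult_ac)
      qed
      also have "\<dots> = ?k * (t powr p / p) - ?k * (t1 powr p / p)" using hi by (rule integral_unique)
      also have "\<dots> \<le> ?k * (t powr p / p)" using c p r by simp
      also have "\<dots> = c / p * ((t powr \<gamma> * t powr p) * rate \<alpha> \<beta> t) * norm x" by simp
      also have "t powr \<gamma> * t powr p = t" using t t1 by (simp add: powr_add[symmetric] \<gamma>_def)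
      finally show ?thesis .
    qed
    also have "\<dots> \<le> C * (t * rate \<alpha> \<beta> t) * norm x"
      using C r t t1 by (intro mult_right_mono) auto
    finally show ?thesis by (simp add: algebra_simps)
  qed
  then show ?thesis using C t1 by blast
qed

text \<open>
  For \<open>z = a + \<i> s\<close>, the truncation error in \<open>R(z) A (1 + A)\<^sup>-\<^sup>1\<close> contains \<open>R(z)\<close> itself, but
  with the factor \<open>r\<close>, which is small enough for it to be absorbed. The resulting bound does not depend on
  \<open>a\<close>, so it persists on the axis as \<open>a\<close> tends to \<open>0\<close>.
\<close>
lemma resolvent_bound_of_truncation:
  assumes res: "is_resolvent D A (\<i> * complex_of_real s) Q" and s: "s \<noteq> 0" and t: "t \<ge> 0"
    and W: "W \<ge> 0" "\<And>z x. Re z > 0 \<Longrightarrow> norm (integral {0..t} (orbit z (gen_res x))) \<le> W * norm x"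
    and decay: "\<And>x. norm (T t (gen_res x)) \<le> r * norm x" and r: "(1 + \<bar>s\<bar>) * r \<le> \<bar>s\<bar> / 2" "r \<ge> 0"
  shows "onorm Q \<le> 2 * ((K + (1 + \<bar>s\<bar>) * W) / \<bar>s\<bar>)"
proof -
  define R where "R = (K + (1 + \<bar>s\<bar>) * W) / \<bar>s\<bar>"
  have R: "R \<ge> 0" unfolding R_def using K_pos W s by (intro divide_nonneg_nonneg add_nonneg_nonneg) auto
  have Q: "bounded_linear Q" using res by (simp add: is_resolvent_def bounded_clinear_linear)
  have laplace_bd: "onorm (laplace (Complex a s)) \<le> 2 * R" if a: "0 < a" "a \<le> 1" for a
  proof -
    let ?z = "Complex a s"
    have z: "Re ?z > 0" using a by simp
    have L: "bounded_linear (laplace ?z)" by (rule bounded_clinear_linear[OF laplace_clinear[OF z]])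
    show ?thesis
    proof (rule onorm_le_twice[OF L])
      fix x
      have "\<bar>s\<bar> * norm (laplace ?z x) \<le> cmod ?z * norm (laplace ?z x)"
        using abs_Im_le_cmod[of ?z] by (intro mult_right_mono) auto
      also have "?z *\<^sub>C laplace ?z x = laplace 1 x - (1 - ?z) *\<^sub>C laplace ?z (gen_res x)"
        using laplace_gen_res(2)[OF z, of x] by simp
      then have "cmod ?z * norm (laplace ?z x) \<le> norm (laplace 1 x) + cmod (1 - ?z) * norm (laplace ?z (gen_res x))"
        unfolding norm_scaleC[symmetric] by (simp add: norm_triangle_ineq4)
      also have "\<dots> \<le> K * norm x + (1 + \<bar>s\<bar>) * (W * norm x + onorm (laplace ?z) * (r * norm x))"
      proof (intro add_mono norm_laplace_1 mult_mono)
        show "cmod (1 - ?z) \<le> 1 + \<bar>s\<bar>" using cmod_le[of "1 - ?z"] a by simp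
        have "norm (laplace ?z (gen_res x)) \<le> norm (integral {0..t} (orbit ?z (gen_res x)))
            + exp (- (a * t)) * norm (laplace ?z (T t (gen_res x)))"
          by (subst laplace_truncation[OF z t], rule order_trans[OF norm_triangle_ineq]) (simp add: norm_scaleC)
        also have "\<dots> \<le> W * norm x + 1 * (onorm (laplace ?z) * (r * norm x))"
        proof (intro add_mono W z mult_mono)
          show "norm (laplace ?z (T t (gen_res x))) \<le> onorm (laplace ?z) * (r * norm x)"
            using onorm[OF L, of "T t (gen_res x)"] mult_left_mono[OF decay[of x] onorm_pos_le[OF L]] by linarith
        qed (use a t in auto)
        finally show "norm (laplace ?z (gen_res x)) \<le> W * norm x + onorm (laplace ?z) * (r * norm x)" by simp
      qed auto
      also have "\<dots> = (K + (1 + \<bar>s\<bar>) * W) * norm x + ((1 + \<bar>s\<bar>) * r) * (onorm (laplace ?z) * norm x)"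
        by (simp add: algebra_simps)
      also have "\<dots> \<le> (K + (1 + \<bar>s\<bar>) * W) * norm x + (\<bar>s\<bar> / 2) * (onorm (laplace ?z) * norm x)"
        using r onorm_pos_le[OF L] by (intro add_left_mono mult_right_mono) auto
      also have "\<dots> = \<bar>s\<bar> * (R * norm x + 1 / 2 * onorm (laplace ?z) * norm x)"
        using s by (simp add: R_def field_simps)
      finally show "norm (laplace ?z x) \<le> R * norm x + 1 / 2 * onorm (laplace ?z) * norm x"
        using s by simp
    qed (use R in auto)
  qed
  have "onorm Q \<le> 2 * R * (1 + 0 * onorm Q)"
  proof (rule tendsto_lowerbound)
    show "((\<lambda>a. 2 * R * (1 + a * onorm Q)) \<longlongrightarrow> 2 * R * (1 + 0 * onorm Q)) (at_right 0)"
      by (intro tendsto_intros)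
    show "\<forall>\<^sub>F a in at_right 0. onorm Q \<le> 2 * R * (1 + a * onorm Q)"
    proof (intro eventually_at_rightI[of 0 1])
      fix a :: real assume a: "a \<in> {0<..<1}"
      let ?z = "Complex a s"
      have z: "Re ?z > 0" using a by simp
      have L: "bounded_linear (laplace ?z)" by (rule bounded_clinear_linear[OF laplace_clinear[OF z]])
      have Lx: "norm (laplace ?z x) \<le> 2 * R * norm x" for x
        using onorm[OF L, of x] mult_right_mono[OF laplace_bd[of a], of "norm x"] a by fastforce
      show "onorm Q \<le> 2 * R * (1 + a * onorm Q)"
      proof (rule onorm_bound)
        fix x
        have "?z - \<i> * complex_of_real s = complex_of_real a" by (simp add: complex_eq_iff)
        then have "Q x = laplace ?z x + complex_of_real a *\<^sub>C Q (laplace ?z x)"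
          using resolvent_identity[OF res is_resolvent_laplace[OF z], of x] by (simp add: algebra_simps)
        then have "norm (Q x) \<le> norm (laplace ?z x) + a * norm (Q (laplace ?z x))"
          using a norm_triangle_ineq[of "laplace ?z x" "complex_of_real a *\<^sub>C Q (laplace ?z x)"] by (simp add: norm_scaleC)
        also have "\<dots> \<le> 2 * R * norm x + a * (onorm Q * (2 * R * norm x))"
        proof (intro add_mono Lx mult_left_mono)
          show "norm (Q (laplace ?z x)) \<le> onorm Q * (2 * R * norm x)"
            using onorm[OF Q, of "laplace ?z x"] mult_left_mono[OF Lx[of x] onorm_pos_le[OF Q]] by linarith
        qed (use a in auto)
        finally show "norm (Q x) \<le> 2 * R * (1 + a * onorm Q) * norm x" by (simp add: algebra_simps)
      qed (use R a onorm_pos_le[OF Q] in auto)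
    qed simp
  qed simp
  then show ?thesis by (simp add: R_def)
qed

text \<open>
  Far from \<open>0\<close> one fixed time serves for all \<open>s\<close>, as the decay rate has only to fall below a
  constant there. Near \<open>0\<close> the time is a multiple of \<open>growth \<alpha> \<beta> \<bar>s\<bar>\<close>, which makes the rate a
  small multiple of \<open>\<bar>s\<bar>\<close> and the truncated integral \<open>O(1 + \<bar>s\<bar> * growth \<alpha> \<beta> \<bar>s\<bar>)\<close>.
\<close>
lemma resolvent_growth_of_decay:
  assumes res: "\<And>s. s \<noteq> 0 \<Longrightarrow> is_resolvent D A (\<i> * complex_of_real s) (Q s)"
    and \<alpha>: "\<alpha> > 1" and \<beta>: "\<beta> \<ge> 0" and c: "c > 0"
    and decay: "\<And>t x. t \<ge> t0 \<Longrightarrow> norm (T t (gen_res x)) \<le> c * rate \<alpha> \<beta> t * norm x"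
  shows "\<exists>C. \<exists>s1>0. \<forall>s. s \<noteq> 0 \<longrightarrow> \<bar>s\<bar> < s1 \<longrightarrow> onorm (Q s) \<le> C * growth \<alpha> \<beta> \<bar>s\<bar>"
    and "\<exists>C. \<forall>s. \<bar>s\<bar> \<ge> 1 \<longrightarrow> onorm (Q s) \<le> C"
proof -
  obtain C t1 where C: "C \<ge> 0" and t1: "t1 > 1"
    and W: "\<And>t z x. t \<ge> t1 \<Longrightarrow> Re z > 0 \<Longrightarrow>
      norm (integral {0..t} (orbit z (gen_res x))) \<le> (C + C * (t * rate \<alpha> \<beta> t)) * norm x"
    using norm_orbit_integral_gen_res[OF \<alpha> \<beta> less_imp_le[OF c] decay] by blast
  have core: "onorm (Q s) \<le> 2 * ((K + (1 + \<bar>s\<bar>) * (C + C * (t * rate \<alpha> \<beta> t))) / \<bar>s\<bar>)"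
    if s: "s \<noteq> 0" and t: "t \<ge> t0" "t \<ge> t1" and r: "(1 + \<bar>s\<bar>) * (c * rate \<alpha> \<beta> t) \<le> \<bar>s\<bar> / 2" for s t
  proof -
    have "rate \<alpha> \<beta> t > 0" using t t1 by (intro rate_pos) auto
    then show ?thesis
      using t t1 C c by (intro resolvent_bound_of_truncation[OF res[OF s] s _ _ W[OF t(2)] decay[OF t(1)] r]) auto
  qed
  show "\<exists>C. \<forall>s. \<bar>s\<bar> \<ge> 1 \<longrightarrow> onorm (Q s) \<le> C"
  proof -
    have "\<forall>\<^sub>F t in at_top. rate \<alpha> \<beta> t < 1 / (4 * c) \<and> t \<ge> t0 \<and> t \<ge> t1"
      using c by (intro eventually_conj eventually_ge_at_top order_tendstoD(2)[OF rate_tendsto_0[OF \<alpha> \<beta>]]) auto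
    then obtain t where t: "rate \<alpha> \<beta> t < 1 / (4 * c)" "t \<ge> t0" "t \<ge> t1"
      using eventually_happens'[OF trivial_limit_at_top_linorder] by blast
    let ?W = "C + C * (t * rate \<alpha> \<beta> t)"
    have W0: "?W \<ge> 0" using C t t1 by (simp add: rate_def)
    have "onorm (Q s) \<le> 2 * (K + 2 * ?W)" if s: "\<bar>s\<bar> \<ge> 1" for s
    proof -
      have cr: "c * rate \<alpha> \<beta> t \<le> 1 / 4" using t c by (simp add: field_simps)
      have "(1 + \<bar>s\<bar>) * (c * rate \<alpha> \<beta> t) \<le> (2 * \<bar>s\<bar>) * (1 / 4)"
        using s c cr by (intro mult_mono) (auto simp: rate_def)
      then have "onorm (Q s) \<le> 2 * ((K + (1 + \<bar>s\<bar>) * ?W) / \<bar>s\<bar>)"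
        using s t by (intro core) auto
      also have "\<dots> \<le> 2 * ((K * \<bar>s\<bar> + (2 * \<bar>s\<bar>) * ?W) / \<bar>s\<bar>)"
        using s K_pos W0 by (intro mult_left_mono divide_right_mono add_mono mult_right_mono) auto
      also have "\<dots> = 2 * (K + 2 * ?W)" using s by (simp add: add_divide_distrib)
      finally show ?thesis .
    qed
    then show ?thesis by blast
  qed
  show "\<exists>C. \<exists>s1>0. \<forall>s. s \<noteq> 0 \<longrightarrow> \<bar>s\<bar> < s1 \<longrightarrow> onorm (Q s) \<le> C * growth \<alpha> \<beta> \<bar>s\<bar>"
  proof -
    have "1 / (4 * c) > 0" using c by simp
    from rate_of_scaled_growth_le[OF \<alpha> \<beta> this] obtain k s0 where k: "k > 0" and s0: "s0 > 0" "s0 < 1"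
      and ks: "\<And>s. 0 < s \<Longrightarrow> s < s0 \<Longrightarrow> 1 / s \<le> k * growth \<alpha> \<beta> s"
        "\<And>s. 0 < s \<Longrightarrow> s < s0 \<Longrightarrow> rate \<alpha> \<beta> (k * growth \<alpha> \<beta> s) \<le> 1 / (4 * c) * s"
      by blast
    \<comment> \<open>Smallness of \<open>s\<close> also ensures that the time chosen for it exceeds \<open>t0\<close> and \<open>t1\<close>.\<close>
    define s1 where "s1 = min s0 (min (1 / t1) (1 / max 1 t0))"
    have s1: "s1 > 0" using s0 t1 by (auto simp: s1_def)
    define E where "E = 2 * ((K + 2 * C) * k + C * k / (2 * c))"
    have "onorm (Q s) \<le> E * growth \<alpha> \<beta> \<bar>s\<bar>" if s: "s \<noteq> 0" "\<bar>s\<bar> < s1" for s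
    proof -
      let ?u = "\<bar>s\<bar>" and ?t = "k * growth \<alpha> \<beta> \<bar>s\<bar>"
      have u: "0 < ?u" "?u < s0" "?u < 1 / t1" "?u < 1 / max 1 t0" using s by (auto simp: s1_def)
      have "t1 \<le> 1 / ?u" "max 1 t0 \<le> 1 / ?u" using u t1 by (auto simp: field_simps max_def split: if_splits)
      then have t: "t1 \<le> ?t" "t0 \<le> ?t" using ks(1)[OF u(1,2)] by auto
      have rt: "rate \<alpha> \<beta> ?t \<le> 1 / (4 * c) * ?u" by (rule ks(2)[OF u(1,2)])
      then have cr: "c * rate \<alpha> \<beta> ?t \<le> ?u / 4" using c by (simp add: field_simps)
      have "(1 + ?u) * (c * rate \<alpha> \<beta> ?t) \<le> 2 * (?u / 4)"
        using u s0 c cr by (intro mult_mono) (auto simp: rate_def)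
      then have "onorm (Q s) \<le> 2 * ((K + (1 + ?u) * (C + C * (?t * rate \<alpha> \<beta> ?t))) / ?u)"
        using s t by (intro core) auto
      also have "\<dots> \<le> 2 * ((K + 2 * (C + C * (?t * (1 / (4 * c) * ?u)))) / ?u)"
        using u s0 C t t1 rt c by (intro mult_left_mono divide_right_mono add_mono mult_mono) (auto simp: rate_def)
      also have "\<dots> = 2 * ((K + 2 * C) * (1 / ?u) + C / (2 * c) * ?t)"
        using u c by (simp add: field_simps)
      also have "\<dots> \<le> 2 * ((K + 2 * C) * ?t + C / (2 * c) * ?t)"
        using K_pos C
        by (intro mult_left_mono[of _ _ 2] add_right_mono mult_left_mono[OF ks(1)[OF u(1,2)]]) auto
      also have "\<dots> = E * growth \<alpha> \<beta> ?u" by (simp add: E_def algebra_simps)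
      finally show ?thesis .
    qed
    then show ?thesis using s1 by blast
  qed
qed

end

section \<open>The equivalence\<close>

theorem theorem1p5:
  fixes T :: "real \<Rightarrow> 'a::chilbert_space \<Rightarrow> 'a"
    and D :: "'a set" and A :: "'a \<Rightarrow> 'a"
    and \<alpha> \<beta> :: real
  assumes "C0_semigroup T" and "bounded_semigroup T"
    and "is_generator T D (\<lambda>x. - A x)"
    and "spectrum D A \<inter> {z. Re z = 0} \<subseteq> {0}"
    and "\<alpha> > 1" and "\<beta> \<ge> 0"
  shows
    "(\<lambda>s::real. onorm (inv_into D (\<lambda>x. (\<i> * complex_of_real s) *\<^sub>C x + A x)))
        \<in> O[at 0](\<lambda>s. \<bar>s\<bar> powr (-\<alpha>) * ln (1 / \<bar>s\<bar>) powr (-\<beta>)) \<and>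
     (\<lambda>s::real. onorm (inv_into D (\<lambda>x. (\<i> * complex_of_real s) *\<^sub>C x + A x)))
        \<in> O[at_infinity](\<lambda>_. 1)
     \<longleftrightarrow>
     (\<lambda>t::real. onorm (\<lambda>x. T t (A (inv_into D (\<lambda>y. y + A y) x))))
        \<in> O[at_top](\<lambda>t. t powr (- 1 / \<alpha>) * ln t powr (- \<beta> / \<alpha>))"
    (is "?near \<and> ?far \<longleftrightarrow> ?decay")
proof -
  obtain M where M: "\<And>t. t \<ge> 0 \<Longrightarrow> onorm (T t) \<le> M"
    using assms(2) by (auto simp: bounded_semigroup_def)
  have normT: "norm (T t x) \<le> max 1 M * norm x" if t: "t \<ge> 0" for t x
  proof -
    have "bounded_linear (T t)"
      using assms(1) t by (simp add: C0_semigroup_def bounded_clinear_linear)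
    from onorm[OF this, of x] show ?thesis
      using mult_right_mono[of "onorm (T t)" "max 1 M" "norm x"] M[OF t] by force
  qed
  interpret bounded_C0_semigroup T D A "max 1 M"
    by unfold_locales (use assms normT in auto)
  define Q where "Q s = inv_into D (\<lambda>x. (\<i> * complex_of_real s) *\<^sub>C x + A x)" for s
  have res: "is_resolvent D A (\<i> * complex_of_real s) (Q s)" if s: "s \<noteq> 0" for s
    unfolding Q_def
  proof (rule is_resolvent_of_resolvent_set)
    have "- (\<i> * complex_of_real s) \<notin> spectrum D A" using assms(4) s by auto
    then show "- (\<i> * complex_of_real s) \<in> resolvent_set D A" by (simp add: spectrum_def)
  qed
  have Ql: "bounded_linear (Q s)" if "s \<noteq> 0" for s
    using res[OF that] by (simp add: is_resolvent_def bounded_clinear_linear)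
  have AR: "A (inv_into D (\<lambda>y. y + A y) x) = gen_res x" for x
  proof -
    have r1: "is_resolvent D A 1 (laplace 1)" by (rule is_resolvent_laplace) simp
    then have "laplace 1 x + A (laplace 1 x) = x" by (simp add: is_resolvent_def)
    then show ?thesis
      using is_resolvent_inv_into[OF r1] by (simp add: gen_res_def algebra_simps)
  qed
  have TBl: "bounded_linear (\<lambda>x. T t (gen_res x))" if "t \<ge> 0" for t
    by (rule bounded_linear_compose[OF T_linear[OF that] bounded_clinear_linear[OF gen_res_clinear]])
  have near_iff: "?near \<longleftrightarrow> (\<exists>C. \<exists>s1>0. \<forall>s. s \<noteq> 0 \<longrightarrow> \<bar>s\<bar> < s1 \<longrightarrow> onorm (Q s) \<le> C * growth \<alpha> \<beta> \<bar>s\<bar>)"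
    (is "_ \<longleftrightarrow> ?N")
  proof
    assume ?near
    then obtain C where "\<forall>\<^sub>F s in at 0. norm (onorm (Q s)) \<le> C * norm (growth \<alpha> \<beta> \<bar>s\<bar>)"
      unfolding Q_def[symmetric] growth_def[symmetric] by (elim landau_o.bigE)
    then obtain d where "d > 0" "\<And>s. s \<noteq> 0 \<Longrightarrow> \<bar>s\<bar> < d \<Longrightarrow> norm (onorm (Q s)) \<le> C * norm (growth \<alpha> \<beta> \<bar>s\<bar>)"
      by (auto simp: eventually_at dist_real_def)
    moreover from this(2) have "onorm (Q s) \<le> C * growth \<alpha> \<beta> \<bar>s\<bar>" if "s \<noteq> 0" "\<bar>s\<bar> < d" for s
      using that by (force simp: growth_def)
    ultimately show ?N by blast
  next
    assume ?N
    then obtain C s1 where s1: "s1 > 0" "\<And>s. s \<noteq> 0 \<Longrightarrow> \<bar>s\<bar> < s1 \<Longrightarrow> onorm (Q s) \<le> C * growth \<alpha> \<beta> \<bar>s\<bar>"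
      by blast
    then have "\<forall>\<^sub>F s in at 0. norm (onorm (Q s)) \<le> C * norm (growth \<alpha> \<beta> \<bar>s\<bar>)"
      using onorm_pos_le[OF Ql] by (auto simp: eventually_at dist_real_def growth_def intro!: exI[of _ s1])
    then show ?near unfolding Q_def[symmetric] growth_def[symmetric] by (rule bigoI)
  qed
  have far_iff: "?far \<longleftrightarrow> (\<exists>C S. \<forall>s. \<bar>s\<bar> \<ge> S \<longrightarrow> onorm (Q s) \<le> C)"
    (is "_ \<longleftrightarrow> ?F")
  proof
    assume ?far
    then obtain C where "\<forall>\<^sub>F s in at_infinity. norm (onorm (Q s)) \<le> C * norm (1::real)"
      unfolding Q_def[symmetric] by (elim landau_o.bigE)
    then obtain S where "\<And>s. \<bar>s\<bar> \<ge> S \<Longrightarrow> norm (onorm (Q s)) \<le> C"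
      by (auto simp: eventually_at_infinity)
    then show ?F by (metis real_norm_def abs_le_D1)
  next
    assume ?F
    then obtain C S where S: "\<And>s. \<bar>s\<bar> \<ge> S \<Longrightarrow> onorm (Q s) \<le> C" by blast
    have "\<forall>\<^sub>F s in at_infinity. norm (onorm (Q s)) \<le> C * norm (1::real)"
      unfolding eventually_at_infinity
    proof (intro exI allI impI)
      fix s :: real assume "max 1 S \<le> norm s"
      then show "norm (onorm (Q s)) \<le> C * norm (1::real)"
        using S[of s] onorm_pos_le[OF Ql[of s]] by auto
    qed
    then show ?far unfolding Q_def[symmetric] by (rule bigoI)
  qed
  have decay_iff: "?decay \<longleftrightarrow> (\<exists>c>0. \<exists>t0. \<forall>t\<ge>t0. \<forall>x. norm (T t (gen_res x)) \<le> c * rate \<alpha> \<beta> t * norm x)"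
    (is "_ \<longleftrightarrow> ?T")
  proof
    assume ?decay
    then obtain c where c: "c > 0" "\<forall>\<^sub>F t in at_top. norm (onorm (\<lambda>x. T t (gen_res x))) \<le> c * norm (rate \<alpha> \<beta> t)"
      unfolding AR rate_def[symmetric] by (elim landau_o.bigE)
    from eventually_conj[OF c(2) eventually_ge_at_top[of 0]]
    obtain t0 where t0: "\<And>t. t \<ge> t0 \<Longrightarrow> norm (onorm (\<lambda>x. T t (gen_res x))) \<le> c * norm (rate \<alpha> \<beta> t) \<and> t \<ge> 0"
      by (auto simp: eventually_at_top_linorder)
    have "norm (T t (gen_res x)) \<le> c * rate \<alpha> \<beta> t * norm x" if t: "t \<ge> t0" for t x
    proof -
      have "onorm (\<lambda>x. T t (gen_res x)) \<le> c * rate \<alpha> \<beta> t" using t0[OF t] by (auto simp: rate_def)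
      from mult_right_mono[OF this, of "norm x"] onorm[OF TBl[of t], of x] t0[OF t]
      show ?thesis by force
    qed
    then show ?T using c by blast
  next
    assume ?T
    then obtain c t0 where c: "c > 0"
      and t0: "\<And>t x. t \<ge> t0 \<Longrightarrow> norm (T t (gen_res x)) \<le> c * rate \<alpha> \<beta> t * norm x" by blast
    have "\<forall>\<^sub>F t in at_top. norm (onorm (\<lambda>x. T t (gen_res x))) \<le> c * norm (rate \<alpha> \<beta> t)"
      unfolding eventually_at_top_linorder
    proof (intro exI allI impI)
      fix t assume t: "max 0 t0 \<le> t"
      have "onorm (\<lambda>x. T t (gen_res x)) \<le> c * rate \<alpha> \<beta> t"
        using t c t0[of t] by (intro onorm_bound) (auto simp: rate_def)
      then show "norm (onorm (\<lambda>x. T t (gen_res x))) \<le> c * norm (rate \<alpha> \<beta> t)"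
        using onorm_pos_le[OF TBl[of t]] t by (simp add: rate_def)
    qed
    then show ?decay unfolding AR rate_def[symmetric] by (rule bigoI)
  qed
  show ?thesis
  proof
    assume "?near \<and> ?far"
    then obtain C1 C2 s1 S where s1: "s1 > 0"
      and C1: "\<And>s. s \<noteq> 0 \<Longrightarrow> \<bar>s\<bar> < s1 \<Longrightarrow> onorm (Q s) \<le> C1 * growth \<alpha> \<beta> \<bar>s\<bar>"
      and C2: "\<And>s. \<bar>s\<bar> \<ge> S \<Longrightarrow> onorm (Q s) \<le> C2"
      unfolding near_iff far_iff by blast
    have C1': "onorm (Q s) \<le> max C1 C2 * growth \<alpha> \<beta> \<bar>s\<bar>" if "s \<noteq> 0" "\<bar>s\<bar> < s1" for s
      using C1[OF that] mult_right_mono[of C1 "max C1 C2" "growth \<alpha> \<beta> \<bar>s\<bar>"] by (simp add: growth_def)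
    have C2': "onorm (Q s) \<le> max C1 C2" if "\<bar>s\<bar> \<ge> S" for s using C2[OF that] by simp
    obtain C t0 where C: "\<And>t x. t \<ge> t0 \<Longrightarrow> norm (T t (gen_res x)) \<le> C * rate \<alpha> \<beta> t * norm x"
      using decay_of_resolvent_growth[OF res assms(5,6) s1 C1' C2'] by blast
    have "norm (T t (gen_res x)) \<le> max 1 C * rate \<alpha> \<beta> t * norm x" if "t \<ge> t0" for t x
      using C[OF that, of x] mult_right_mono[of C "max 1 C" "rate \<alpha> \<beta> t * norm x"] by (simp add: rate_def mult.assoc)
    moreover have "max 1 C > 0" by simp
    ultimately show ?decay unfolding decay_iff by blast
  next
    assume ?decay
    then obtain c t0 where "c > 0"
      and "\<And>t x. t \<ge> t0 \<Longrightarrow> norm (T t (gen_res x)) \<le> c * rate \<alpha> \<beta> t * norm x"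
      unfolding decay_iff by blast
    from resolvent_growth_of_decay[OF res assms(5,6) this] show "?near \<and> ?far"
      unfolding near_iff far_iff by blast
  qed
qed

end
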